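(* Let $I=(I_1,\ldots,I_p)$ and $J=(J_1,\ldots,J_q)$ be finite integer sequences (not necessarily partitions), and let $I,J=(I_1,\ldots,I_p,J_1,\ldots,J_q)$ denote their concatenation. Define the multiplication kernel \[ K_{p,q}(\mathbf{t})=\prod_{i=1}^{p}\frac{(1-t_i)^{q}}{\prod_{j=1}^{q}\left(1-t_i t_{p+j}^{-1}\right)}. \] Then \[ G_I\cdot G_J=\mathcal{G}_{\mathbf{t}}\left(t^{I,J}\,K_{p,q}(\mathbf{t})\right). \]
   Context: Let $\boldsymbol{\alpha}=(\alpha_1,\ldots,\alpha_N)$, $\boldsymbol{\beta}=(\beta_1,\ldots,\beta_{N'})$ be variables. For an integer sequence $I=(I_1,\ldots,I_p)$ the (possibly "fake", i.e. $I$ need not be a partition) double stable Grothendieck polynomial is \[ G_I(\boldsymbol{\alpha};\boldsymbol{\beta})=\mathrm{IR}_{\mathbf{z}=0,\infty}\Big(\prod_{j=1}^p(1-z_j)^{I_j-j}\,\kappa_p(\boldsymbol{\alpha};\boldsymbol{\beta}|\mathbf{z})\Big), \] \[ \kappa_p(\boldsymbol{\alpha};\boldsymbol{\beta}|\mathbf{z})=\Big(\prod_{i=1}^p\frac{\prod_{b\in\boldsymbol\beta}(1-z_ib)}{\prod_{a\in\boldsymbol\alpha}(1-z_ia)}\cdot\frac{dz_i}{z_i(1-z_i)^{N-N'}}\Big)\prod_{1\le i<j\le p}\Big(1-\frac{z_j}{z_i}\Big), \] where $\mathrm{IR}_{\mathbf{z}=0,\infty}$ means: apply $\mathrm{Res}_{z_1=0}+\mathrm{Res}_{z_1=\infty}$,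 then $\mathrm{Res}_{z_2=0}+\mathrm{Res}_{z_2=\infty}$, and so on up to $z_p$. One writes $G_I$ when a statement holds independently of the variables. For an ordered alphabet $\mathbf{t}=(t_1,t_2,\ldots)$ and a finite integer sequence $I=(I_1,\ldots,I_n)$ write $t^I=\prod_{j}t_j^{I_j}$. The operation $\mathcal{G}_{\mathbf{t}}$ is defined by $\mathcal{G}_{\mathbf{t}}(t^I)=G_I$, extended $\mathbb{Z}$-linearly to formal Laurent series in $\mathbf{t}$ for which the result is a finite $\mathbb{Z}$-linear combination of stable Grothendieck polynomials; a rational function in $\mathbf{t}$ is replaced by its Laurent expansion on the domain $|t_i|<|t_j|$ for $i<j$ (e.g. $1/(1-t_i/t_j)=\sum_{k\ge0}(t_i/t_j)^k$ for $i<j$). *)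

theory Defs
  imports "HOL-Complex_Analysis.Complex_Analysis" "HOL-Library.Function_Algebras"
begin

definition residue_infinity :: "(complex \<Rightarrow> complex) \<Rightarrow> complex" where
  "residue_infinity f = - residue (\<lambda>w. f (1 / w) / w\<^sup>2) 0"

text \<open>The residues in the first variable are taken first, the remaining variables being
  parameters.\<close>

primrec iterated_residue :: "nat \<Rightarrow> (complex list \<Rightarrow> complex) \<Rightarrow> complex" where
  "iterated_residue 0 f = f []"
| "iterated_residue (Suc p) f =
     iterated_residue p (\<lambda>zs. residue (\<lambda>z. f (z # zs)) 0 + residue_infinity (\<lambda>z. f (z # zs)))"

text \<open>The alphabets are \<open>\<alpha> 1, \<dots>, \<alpha> N\<close> and \<open>\<beta> 1, \<dots>, \<beta> N'\<close>. Lists are indexed from \<open>0\<close>, so that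
  the variable written \<open>z\<^sub>j\<close> on paper is \<open>zs ! (j - 1)\<close>. Pitfall: other sources use the exponent
  \<open>N' - N\<close> in place of \<open>N - N'\<close>; the two normalisations agree only for \<open>N = N'\<close>.\<close>

definition kappa ::
    "nat \<Rightarrow> nat \<Rightarrow> (nat \<Rightarrow> complex) \<Rightarrow> (nat \<Rightarrow> complex) \<Rightarrow> complex list \<Rightarrow> complex" where
  "kappa N N' \<alpha> \<beta> zs =
     (\<Prod>i<length zs. (\<Prod>b=1..N'. 1 - zs ! i * \<beta> b) / (\<Prod>a=1..N. 1 - zs ! i * \<alpha> a)
        * (1 / (zs ! i * (1 - zs ! i) powi (int N - int N')))) *
     (\<Prod>j<length zs. \<Prod>i<j. 1 - zs ! j / zs ! i)"

text \<open>For fixed sizes of the alphabets, a Grothendieck polynomial is the function of all values of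
  the variables; sums and products of such functions are pointwise.\<close>

definition grothendieck ::
    "nat \<Rightarrow> nat \<Rightarrow> int list \<Rightarrow> (nat \<Rightarrow> complex) \<Rightarrow> (nat \<Rightarrow> complex) \<Rightarrow> complex" where
  "grothendieck N N' I = (\<lambda>\<alpha> \<beta>. iterated_residue (length I)
     (\<lambda>zs. (\<Prod>j<length I. (1 - zs ! j) powi (I ! j - (int j + 1))) * kappa N N' \<alpha> \<beta> zs))"

definition monomial :: "complex list \<Rightarrow> int list \<Rightarrow> complex" where
  "monomial t I = (\<Prod>j<length I. (t ! j) powi (I ! j))"

text \<open>A formal Laurent series in \<open>n\<close> variables with integer coefficients is represented by its
  coefficient function on exponent vectors, which are lists of length \<open>n\<close>. The domain of expansion
  is \<open>|t\<^sub>i| < |t\<^sub>j|\<close> for \<open>i < j\<close>.\<close>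

definition is_laurent_expansion ::
    "nat \<Rightarrow> (complex list \<Rightarrow> complex) \<Rightarrow> (int list \<Rightarrow> int) \<Rightarrow> bool" where
  "is_laurent_expansion n R c \<longleftrightarrow>
     (\<forall>e. length e \<noteq> n \<longrightarrow> c e = 0) \<and>
     (\<forall>t. length t = n \<and> 0 \<notin> set t \<and> sorted_wrt (\<lambda>x y. norm x < norm y) t \<longrightarrow>
        ((\<lambda>e. of_int (c e) * monomial t e) has_sum R t) {e. length e = n})"

text \<open>Evaluating a Laurent series term by term gives infinitely many nonzero terms in general,
  already for \<open>(1 - t\<^sub>1) / (1 - t\<^sub>1 / t\<^sub>2)\<close>: finiteness holds only after collecting the terms with the
  same powers of the leading variables. The sum is therefore iterated, following the iterated
  Laurent series in which \<open>|t\<^sub>1| < |t\<^sub>2| < \<dots>\<close> expansions live: powers of \<open>t\<^sub>1\<close> are outermost, the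
  coefficient of each of them being evaluated by the same rule in the remaining variables. At each
  stage only finitely many of the partial results may be nonzero, so the total is a finite
  sum of values of \<open>f\<close>.\<close>

primrec has_iterated_sum :: "nat \<Rightarrow> (int list \<Rightarrow> 'a::comm_monoid_add) \<Rightarrow> 'a \<Rightarrow> bool" where
  "has_iterated_sum 0 f s \<longleftrightarrow> s = f []"
| "has_iterated_sum (Suc n) f s \<longleftrightarrow>
     (\<exists>g. (\<forall>k. has_iterated_sum n (\<lambda>e. f (k # e)) (g k)) \<and>
          finite {k. g k \<noteq> 0} \<and> s = (\<Sum>k | g k \<noteq> 0. g k))"

lemma has_iterated_sum_unique:
  "has_iterated_sum n f s \<Longrightarrow> has_iterated_sum n f s' \<Longrightarrow> s = s'"
proof (induction n arbitrary: f s s')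
  case (Suc n)
  from Suc.prems obtain g g' where
    g: "\<And>k. has_iterated_sum n (\<lambda>e. f (k # e)) (g k)" "s = (\<Sum>k | g k \<noteq> 0. g k)" and
    g': "\<And>k. has_iterated_sum n (\<lambda>e. f (k # e)) (g' k)" "s' = (\<Sum>k | g' k \<noteq> 0. g' k)"
    by auto
  have "g = g'"
    using Suc.IH g(1) g'(1) by blast
  then show ?case
    using g(2) g'(2) by simp
qed simp

definition has_groth_value ::
    "nat \<Rightarrow> nat \<Rightarrow> nat \<Rightarrow> (complex list \<Rightarrow> complex) \<Rightarrow>
     ((nat \<Rightarrow> complex) \<Rightarrow> (nat \<Rightarrow> complex) \<Rightarrow> complex) \<Rightarrow> bool" where
  "has_groth_value N N' n R s \<longleftrightarrow>
     (\<exists>c. is_laurent_expansion n R c \<and>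
          has_iterated_sum n (\<lambda>e. of_int (c e) * grothendieck N N' e) s)"

text \<open>The pair below is the operation written as a calligraphic G with subscript t: its domain and
  its value, which is meaningful on the domain only.\<close>

definition groth_defined :: "nat \<Rightarrow> nat \<Rightarrow> nat \<Rightarrow> (complex list \<Rightarrow> complex) \<Rightarrow> bool" where
  "groth_defined N N' n R \<longleftrightarrow> (\<exists>s. has_groth_value N N' n R s)"

definition groth_op ::
    "nat \<Rightarrow> nat \<Rightarrow> nat \<Rightarrow> (complex list \<Rightarrow> complex) \<Rightarrow>
     (nat \<Rightarrow> complex) \<Rightarrow> (nat \<Rightarrow> complex) \<Rightarrow> complex" where
  "groth_op N N' n R = (THE s. has_groth_value N N' n R s)"

definition mult_kernel :: "nat \<Rightarrow> nat \<Rightarrow> complex list \<Rightarrow> complex" where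
  "mult_kernel p q t =
     (\<Prod>i<p. (1 - t ! i) ^ q / (\<Prod>j<q. 1 - t ! i * inverse (t ! (p + j))))"

end

theory Submission
  imports Defs
begin

text \<open>
  Write \<open>t\<^sub>i = 1 - z\<^sub>i\<close> and, for the last \<open>q\<close> variables, \<open>s\<^sub>l = t\<^bsub>p+l\<^esub>\<close>, \<open>y\<^sub>l = z\<^bsub>p+l\<^esub>\<close>. The
  iterated residue is a product of one-variable functionals \<open>Res\<^sub>0 + Res\<^sub>\<infinity>\<close> on Laurent polynomials
  in the \<open>z\<^sub>i\<close> and \<open>t\<^sub>i\<close>, so a finite sum of terms \<open>c t\<^sup>e\<close> is sent to the residue of its value
  against the kernel of \<open>G\<close>. Since \<open>(1 - t\<^sub>i) / (1 - t\<^sub>i / s\<^sub>l)\<close> equals \<open>s\<^sub>l / (1 - y\<^sub>l / z\<^sub>i)\<close>,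
  multiplying by the closed form of \<open>K\<close> cancels exactly the interaction between the two blocks of
  variables and leaves the integrand of \<open>G\<^sub>I \<sqdot> G\<^sub>J\<close>.

  It remains to see that \<open>K\<close> may be expanded in one \<open>t\<^sub>i\<close> after the other. By partial fractions in
  \<open>t = t\<^sub>i\<close>, the remainder of \<open>(1 - t)\<^sup>q / \<Prod>\<^sub>l (1 - t / s\<^sub>l)\<close> after the power \<open>t\<^sup>K\<close> is a sum over \<open>j\<close> of terms
  proportional to \<open>y\<^sub>j\<^sup>q (t / s\<^sub>j)\<^bsup>K+1\<^esup> / \<Prod>\<^bsub>l\<noteq>j\<^esub> (y\<^sub>j - y\<^sub>l)\<close>. The denominators divide the Vandermonde factor of
  the kernel, the factor \<open>y\<^sub>j\<^sup>q\<close> removes the pole at \<open>y\<^sub>j = 0\<close>, and for large \<open>K\<close> the factor \<open>s\<^sub>j\<^bsup>-K-1\<^esup>\<close>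
  removes the pole at \<open>y\<^sub>j = \<infinity>\<close>. So every remainder with \<open>K\<close> large is killed, uniformly in \<open>\<alpha>\<close> and \<open>\<beta>\<close>.
\<close>

section \<open>Residues at zero and infinity in one variable\<close>

text \<open>One factor of \<open>kappa\<close> without its \<open>1 / z\<close>. The alphabets enter
  the integrand only here; what remains is a Laurent polynomial in the \<open>z_j\<close> and
  \<open>1 - z_j\<close>.\<close>

definition weight ::
    "nat \<Rightarrow> nat \<Rightarrow> (nat \<Rightarrow> complex) \<Rightarrow> (nat \<Rightarrow> complex) \<Rightarrow> complex \<Rightarrow> complex" where
  "weight N N' \<alpha> \<beta> z =
     (\<Prod>b=1..N'. 1 - z * \<beta> b) / (\<Prod>a=1..N. 1 - z * \<alpha> a) * (1 / (1 - z) powi (int N - int N'))"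

definition basic ::
    "nat \<Rightarrow> nat \<Rightarrow> (nat \<Rightarrow> complex) \<Rightarrow> (nat \<Rightarrow> complex) \<Rightarrow> int \<Rightarrow> int \<Rightarrow> complex \<Rightarrow> complex" where
  "basic N N' \<alpha> \<beta> a b z = z powi a * (1 - z) powi b * weight N N' \<alpha> \<beta> z"

definition res_0_inf :: "(complex \<Rightarrow> complex) \<Rightarrow> complex" where
  "res_0_inf f = residue f 0 + residue_infinity f"

text \<open>The iterated residue only sees its argument on these lists: the first entry tends to \<open>0\<close> or
  \<open>\<infinity>\<close> while the others stay fixed.\<close>

definition generic :: "nat \<Rightarrow> complex list set" where
  "generic n = {zs. length zs = n \<and> distinct zs \<and> 0 \<notin> set zs \<and> 1 \<notin> set zs}"

lemma eventually_at_0_notin_finite: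
  assumes "finite A"
  shows "eventually (\<lambda>z::complex. z \<noteq> 0 \<and> z \<notin> A) (at 0)"
proof -
  have "open (- (A - {0}))"
    using assms by (intro open_Compl finite_imp_closed) auto
  then have "eventually (\<lambda>z. z \<in> - (A - {0})) (at 0)"
    by (intro eventually_at_in_open') auto
  then show ?thesis
    using eventually_neq_at_within[of 0 0] by eventually_elim auto
qed

text \<open>Removing 0 also covers \<open>\<alpha> i = 0\<close>, where
  \<open>inverse (\<alpha> i)\<close> is 0.\<close>

lemma basic_holomorphic:
  "basic N N' \<alpha> \<beta> a b holomorphic_on - insert 1 ((\<lambda>i. inverse (\<alpha> i)) ` {1..N}) - {0}"
proof -
  have *: "1 - z * \<alpha> i \<noteq> 0" if "z \<notin> insert 1 ((\<lambda>i. inverse (\<alpha> i)) ` {1..N})" "i \<in> {1..N}" for z i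
  proof
    assume "1 - z * \<alpha> i = 0"
    then have "\<alpha> i * z = 1" by (simp add: mult.commute)
    then have "z = inverse (\<alpha> i)" using inverse_unique by metis
    then show False using that by blast
  qed
  show ?thesis
    unfolding basic_def weight_def
    by (intro holomorphic_intros) (use * in auto)
qed

text \<open>The case distinction gives the removable value at \<open>x = 0\<close> when \<open>\<alpha> i = 0\<close>.\<close>

definition basic_inf ::
    "nat \<Rightarrow> nat \<Rightarrow> (nat \<Rightarrow> complex) \<Rightarrow> (nat \<Rightarrow> complex) \<Rightarrow> int \<Rightarrow> int \<Rightarrow> complex \<Rightarrow> complex" where
  "basic_inf N N' \<alpha> \<beta> a b x =
     x powi (int N - 2 * int N' - a - b - 2) * (x - 1) powi (b - (int N - int N')) *
     (\<Prod>i=1..N'. x - \<beta> i) * (\<Prod>i=1..N. if \<alpha> i = 0 then 1 else x / (x - \<alpha> i))"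

text \<open>This is the substitution \<open>z = 1 / x\<close>. In the exponent of \<open>x\<close>,
  \<open>- a\<close> comes from \<open>z powi a\<close>, \<open>int N - int N' - b\<close> from the
  powers of \<open>1 - z\<close>, \<open>- int N'\<close> from the numerators with \<beta>, and
  \<open>- 2\<close> from \<open>dz\<close>. The denominators with \<alpha> turn into factors that
  are regular at \<open>x = 0\<close>.\<close>

lemma basic_at_inverse:
  assumes x: "x \<noteq> 0" "x \<noteq> 1"
  shows "basic N N' \<alpha> \<beta> a b (1 / x) / x\<^sup>2 = basic_inf N N' \<alpha> \<beta> a b x"
proof -
  have 1: "(\<Prod>b=1..N'. 1 - 1 / x * \<beta> b) = (\<Prod>i=1..N'. x - \<beta> i) / x ^ N'"
  proof -
    have "(\<Prod>b=1..N'. 1 - 1 / x * \<beta> b) = (\<Prod>i=1..N'. (x - \<beta> i) / x)"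
      using x by (intro prod.cong) (auto simp: field_simps)
    also have "\<dots> = (\<Prod>i=1..N'. x - \<beta> i) / x ^ N'"
      by (simp add: prod_dividef)
    finally show ?thesis .
  qed
  have 2: "1 / (\<Prod>a=1..N. 1 - 1 / x * \<alpha> a) = (\<Prod>i=1..N. if \<alpha> i = 0 then 1 else x / (x - \<alpha> i))"
    (is "_ = ?A")
  proof -
    have "1 / (\<Prod>a=1..N. 1 - 1 / x * \<alpha> a) = (\<Prod>a=1..N. 1 / (1 - 1 / x * \<alpha> a))"
      by (simp add: prod_dividef)
    also have "\<dots> = ?A"
      \<comment> \<open>At \<open>x = \<alpha> i\<close> both sides are 0, since division by 0 gives
        0.\<close>
      using x by (intro prod.cong) (auto simp: field_simps)
    finally show ?thesis .
  qed
  have 3: "(1 - 1 / x) powi m = (x - 1) powi m * x powi (- m)" for m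
  proof -
    have "1 - 1 / x = (x - 1) * inverse x" using x by (simp add: field_simps)
    then show ?thesis by (simp add: power_int_mult_distrib power_int_inverse power_int_minus)
  qed
  have 4: "(1 / x) powi a = x powi (- a)"
    by (simp add: power_int_minus power_int_inverse flip: inverse_eq_divide)
  have 5: "(1 - 1 / x) powi b * (1 / (1 - 1/x) powi (int N - int N')) = (1 - 1/x) powi (b - (int N - int N'))"
    using x by (simp add: power_int_diff)
  have "basic N N' \<alpha> \<beta> a b (1 / x) / x\<^sup>2 =
     (1 / x) powi a * ((1 - 1 / x) powi b * (1 / (1 - 1/x) powi (int N - int N')))
     * (\<Prod>b=1..N'. 1 - 1 / x * \<beta> b) * (1 / (\<Prod>a=1..N. 1 - 1 / x * \<alpha> a)) / x\<^sup>2"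
    by (simp add: basic_def weight_def)
  also have "\<dots> = (x powi (- a) * x powi (- (b - (int N - int N'))) / x ^ N' / x\<^sup>2)
       * (x - 1) powi (b - (int N - int N')) * (\<Prod>i=1..N'. x - \<beta> i) * ?A"
    unfolding 5 unfolding 1 2 3 4 by (simp add: mult_ac)
  also have "x powi (- a) * x powi (- (b - (int N - int N'))) / x ^ N' / x\<^sup>2 =
      x powi (- a) * x powi (- (b - (int N - int N'))) * x powi (- int N') * x powi (-2)"
    by (simp add: power_int_minus divide_inverse)
  also have "\<dots> = x powi (int N - 2 * int N' - a - b - 2)"
    using x by (simp flip: power_int_add) (simp add: algebra_simps)
  finally show ?thesis by (simp only: basic_inf_def)
qed

text \<open>The inequality says that the exponent of \<open>x\<close> is nonnegative, so that the
  point 0, which stands for \<open>z = \<infinity>\<close>, is not a pole.\<close>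

lemma basic_inf_holomorphic:
  assumes "S \<subseteq> - insert 1 (\<alpha> ` {1..N} - {0})"
    and "0 \<notin> S \<or> a + b + 2 + 2 * int N' \<le> int N"
  shows "basic_inf N N' \<alpha> \<beta> a b holomorphic_on S"
proof -
  have "(\<lambda>x. if \<alpha> i = 0 then 1 else x / (x - \<alpha> i)) holomorphic_on S" if "i \<in> {1..N}" for i
  proof (cases "\<alpha> i = 0")
    case False
    then have "x - \<alpha> i \<noteq> 0" if "x \<in> S" for x
      using assms(1) that \<open>i \<in> {1..N}\<close> by auto
    then show ?thesis using False by (auto intro!: holomorphic_intros)
  qed auto
  then show ?thesis
    unfolding basic_inf_def
    by (intro holomorphic_intros) (use assms in auto)
qed

lemma residue_sum_list_lmul:
  assumes "open S" "z \<in> S" "\<And>x. x \<in> set xs \<Longrightarrow> f x holomorphic_on S - {z}"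
  shows "residue (\<lambda>w. \<Sum>x\<leftarrow>xs. c x * f x w) z = (\<Sum>x\<leftarrow>xs. c x * residue (f x) z)"
  using assms(3)
proof (induction xs)
  case Nil
  then show ?case by (simp add: residue_const)
next
  case (Cons x xs)
  have "(\<lambda>w. \<Sum>x\<leftarrow>xs. c x * f x w) holomorphic_on S - {z}"
    using Cons.prems by (induction xs) (auto intro!: holomorphic_intros)
  then show ?case
    using Cons assms(1,2)
    by (simp add: residue_add[of S] residue_lmul[of S] holomorphic_intros)
qed

text \<open>Residues are local: the decomposition of \<open>f\<close> is needed only near 0 and,
  through \<open>z = 1 / w\<close>, near infinity. This lets the iterated residue ignore
  coincidences between variables.\<close>

lemma res_0_inf_basic_sum:
  assumes "\<forall>\<^sub>F z in at 0. f z = (\<Sum>x\<leftarrow>xs. c x * basic N N' \<alpha> \<beta> (a x) (b x) z)"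
    and "\<forall>\<^sub>F w in at 0. f (1 / w) = (\<Sum>x\<leftarrow>xs. c x * basic N N' \<alpha> \<beta> (a x) (b x) (1 / w))"
  shows "res_0_inf f = (\<Sum>x\<leftarrow>xs. c x * res_0_inf (basic N N' \<alpha> \<beta> (a x) (b x)))"
proof -
  let ?B = "\<lambda>x. basic N N' \<alpha> \<beta> (a x) (b x)"
  have opn: "open (- A)" if "finite A" for A :: "complex set"
    using that by (intro open_Compl finite_imp_closed)
  have "residue f 0 = residue (\<lambda>w. \<Sum>x\<leftarrow>xs. c x * ?B x w) 0"
    using assms(1) by (intro residue_cong) auto
  also have "\<dots> = (\<Sum>x\<leftarrow>xs. c x * residue (?B x) 0)"
  proof (rule residue_sum_list_lmul)
    let ?A = "insert 1 ((\<lambda>i. inverse (\<alpha> i)) ` {1..N})"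
    show "open (- (?A - {0}))"
      by (intro opn) auto
    show "?B x holomorphic_on - (?A - {0}) - {0}" for x
      by (rule holomorphic_on_subset[OF basic_holomorphic]) auto
  qed auto
  finally have 1: "residue f 0 = (\<Sum>x\<leftarrow>xs. c x * residue (?B x) 0)" .
  let ?A = "insert 1 (\<alpha> ` {1..N} - {0})"
  \<comment> \<open>Kept general in \<open>g\<close>, because it serves both for \<open>f\<close>
    and, as \<open>inf1\<close>, for a single basic function.\<close>
  have inf: "residue (\<lambda>w. g (1 / w) / w\<^sup>2) 0 = (\<Sum>x\<leftarrow>xs. c' x * residue (basic_inf N N' \<alpha> \<beta> (a x) (b x)) 0)"
    if "\<forall>\<^sub>F w in at 0. g (1 / w) = (\<Sum>x\<leftarrow>xs. c' x * ?B x (1 / w))" for g xs and c' :: "_ \<Rightarrow> complex"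
  proof -
    have eq: "\<forall>\<^sub>F w in at 0. g (1 / w) / w\<^sup>2 = (\<Sum>x\<leftarrow>xs. c' x * basic_inf N N' \<alpha> \<beta> (a x) (b x) w)"
      using that eventually_at_0_notin_finite[of "{1}", simplified]
    proof eventually_elim
      case (elim w)
      have "g (1 / w) / w\<^sup>2 = (\<Sum>x\<leftarrow>xs. c' x * (?B x (1 / w) / w\<^sup>2))"
        unfolding elim(1) by (induction xs) (simp_all add: add_divide_distrib)
      then show ?case
        using elim(2) by (simp add: basic_at_inverse)
    qed
    have "residue (\<lambda>w. g (1 / w) / w\<^sup>2) 0 = residue (\<lambda>w. \<Sum>x\<leftarrow>xs. c' x * basic_inf N N' \<alpha> \<beta> (a x) (b x) w) 0"
      using eq by (intro residue_cong) auto
    also have "\<dots> = (\<Sum>x\<leftarrow>xs. c' x * residue (basic_inf N N' \<alpha> \<beta> (a x) (b x)) 0)"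
    proof (rule residue_sum_list_lmul)
      show "open (- ?A)"
        by (intro opn) auto
      show "basic_inf N N' \<alpha> \<beta> (a x) (b x) holomorphic_on - ?A - {0}" for x
        by (rule basic_inf_holomorphic) auto
    qed auto
    finally show ?thesis .
  qed
  have inf1: "residue (\<lambda>w. ?B x (1 / w) / w\<^sup>2) 0 = residue (basic_inf N N' \<alpha> \<beta> (a x) (b x)) 0" for x
    using inf[of "?B x" "\<lambda>_. 1" "[x]"] by simp
  show ?thesis
    unfolding res_0_inf_def residue_infinity_def 1 inf[OF assms(2)] inf1
    by (induction xs) (simp_all add: algebra_simps)
qed

text \<open>The first hypothesis excludes a pole at 0 and the second one at infinity, so both
  residues vanish separately. All cancellation of remainders rests on this criterion.\<close>

lemma res_0_inf_basic_eq_0: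
  assumes "a \<ge> 0" and "a + b + 2 + 2 * int N' \<le> int N"
  shows "res_0_inf (basic N N' \<alpha> \<beta> a b) = 0"
proof -
  have opn: "open (- A)" if "finite A" for A :: "complex set"
    using that by (intro open_Compl finite_imp_closed)
  \<comment> \<open>The point 0 is taken out since \<open>\<alpha> i = 0\<close> contributes
    \<open>inverse 0 = 0\<close>, where the factor \<open>1 - z * \<alpha> i\<close> has no
    zero.\<close>
  let ?A = "insert 1 ((\<lambda>i. inverse (\<alpha> i)) ` {1..N}) - {0}"
  have 1: "residue (basic N N' \<alpha> \<beta> a b) 0 = 0"
  proof (rule residue_holo)
    show "open (- ?A)"
      by (intro opn) auto
    have *: "1 - z * \<alpha> i \<noteq> 0" if "z \<notin> ?A" "i \<in> {1..N}" for z i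
    proof
      assume "1 - z * \<alpha> i = 0"
      then have *: "\<alpha> i * z = 1" by (simp add: mult.commute)
      then have "z = inverse (\<alpha> i)" using inverse_unique by metis
      moreover have "z \<noteq> 0" using * by auto
      ultimately show False using that by blast
    qed
    show "basic N N' \<alpha> \<beta> a b holomorphic_on - ?A"
      unfolding basic_def weight_def
      by (intro holomorphic_intros) (use * assms in auto)
  qed auto
  have "residue (\<lambda>w. basic N N' \<alpha> \<beta> a b (1 / w) / w\<^sup>2) 0 = residue (basic_inf N N' \<alpha> \<beta> a b) 0"
    using eventually_at_0_notin_finite[of "{1}"]
    by (intro residue_cong) (auto elim!: eventually_mono simp: basic_at_inverse)
  also have "\<dots> = 0"
  proof (rule residue_holo)
    show "open (- insert 1 (\<alpha> ` {1..N} - {0}))"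
      by (intro opn) auto
    show "basic_inf N N' \<alpha> \<beta> a b holomorphic_on - insert 1 (\<alpha> ` {1..N} - {0})"
      using assms by (intro basic_inf_holomorphic) auto
  qed auto
  finally show ?thesis
    using 1 by (simp add: res_0_inf_def residue_infinity_def)
qed

section \<open>Iterated residues of Laurent polynomials\<close>

lemma generic_Cons:
  "z # zs \<in> generic (Suc n) \<longleftrightarrow> z \<notin> set zs \<and> z \<noteq> 0 \<and> z \<noteq> 1 \<and> zs \<in> generic n"
  by (auto simp: generic_def)

lemma generic_nth:
  assumes "zs \<in> generic n" "j < n"
  shows "zs ! j \<noteq> 0" "zs ! j \<noteq> 1"
proof -
  have "zs ! j \<in> set zs" using assms by (simp add: generic_def)
  then show "zs ! j \<noteq> 0" "zs ! j \<noteq> 1" using assms(1) by (auto simp: generic_def)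
qed

lemma eventually_generic_Cons:
  assumes "zs \<in> generic n"
  shows "\<forall>\<^sub>F z in at 0. z # zs \<in> generic (Suc n)" "\<forall>\<^sub>F w in at 0. 1 / w # zs \<in> generic (Suc n)"
proof -
  show "\<forall>\<^sub>F z in at 0. z # zs \<in> generic (Suc n)"
    using eventually_at_0_notin_finite[of "insert 1 (set zs)"] assms
    by (auto elim!: eventually_mono simp: generic_Cons)
  have *: "\<forall>\<^sub>F w in at 0. w \<noteq> 0 \<and> w \<notin> insert 1 (inverse ` set zs)"
    by (intro eventually_at_0_notin_finite) auto
  show "\<forall>\<^sub>F w in at 0. 1 / w # zs \<in> generic (Suc n)"
    using *
  proof eventually_elim
    case (elim w)
    have "1 / w \<notin> set zs"
    proof
      assume "1 / w \<in> set zs"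
      then have "inverse (1 / w) \<in> inverse ` set zs" by blast
      then show False using elim by simp
    qed
    then show ?case using elim assms by (auto simp: generic_Cons)
  qed
qed

text \<open>For the residues in the first variable, the factors in the other variables are constants
  and join the coefficient. The number produced by the first variable then joins the coefficient in
  the induction hypothesis, which is why \<open>c\<close> is generalised.\<close>

lemma iterated_residue_sum_basic:
  assumes "\<And>zs. zs \<in> generic n \<Longrightarrow>
    f zs = (\<Sum>x\<leftarrow>xs. c x * (\<Prod>j<n. basic N N' \<alpha> \<beta> (a x j) (b x j) (zs ! j)))"
  shows "iterated_residue n f = (\<Sum>x\<leftarrow>xs. c x * (\<Prod>j<n. res_0_inf (basic N N' \<alpha> \<beta> (a x j) (b x j))))"
  using assms
proof (induction n arbitrary: f c a b)
  case 0
  then show ?case by (simp add: generic_def)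
next
  case (Suc n)
  let ?L = "\<lambda>x. res_0_inf (basic N N' \<alpha> \<beta> (a x 0) (b x 0))"
  have "iterated_residue n (\<lambda>zs. res_0_inf (\<lambda>z. f (z # zs))) =
     (\<Sum>x\<leftarrow>xs. (c x * ?L x) * (\<Prod>j<n. res_0_inf (basic N N' \<alpha> \<beta> (a x (Suc j)) (b x (Suc j)))))"
  proof (rule Suc.IH)
    fix zs assume zs: "zs \<in> generic n"
    let ?c = "\<lambda>x. c x * (\<Prod>j<n. basic N N' \<alpha> \<beta> (a x (Suc j)) (b x (Suc j)) (zs ! j))"
    have eq: "f (z # zs) = (\<Sum>x\<leftarrow>xs. ?c x * basic N N' \<alpha> \<beta> (a x 0) (b x 0) z)"
      if "z # zs \<in> generic (Suc n)" for z
      unfolding Suc.prems[OF that] prod.lessThan_Suc_shift by (simp add: mult_ac)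
    have "res_0_inf (\<lambda>z. f (z # zs)) = (\<Sum>x\<leftarrow>xs. ?c x * ?L x)"
      by (intro res_0_inf_basic_sum eventually_mono[OF eventually_generic_Cons(1)[OF zs]]
          eventually_mono[OF eventually_generic_Cons(2)[OF zs]]) (fact eq)+
    then show "res_0_inf (\<lambda>z. f (z # zs)) =
      (\<Sum>x\<leftarrow>xs. (c x * ?L x) * (\<Prod>j<n. basic N N' \<alpha> \<beta> (a x (Suc j)) (b x (Suc j)) (zs ! j)))"
      by (simp add: mult_ac)
  qed
  then show ?case
    unfolding prod.lessThan_Suc_shift by (simp add: res_0_inf_def mult_ac)
qed

text \<open>The residue functional on the part of the integrand that is free of \<alpha> and
  \<beta>. Its value is a function of the alphabets, so an equation between values of
  \<open>Xi\<close> holds uniformly in them.\<close>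

definition Xi ::
    "nat \<Rightarrow> nat \<Rightarrow> nat \<Rightarrow> (complex list \<Rightarrow> complex) \<Rightarrow> (nat \<Rightarrow> complex) \<Rightarrow> (nat \<Rightarrow> complex) \<Rightarrow> complex" where
  "Xi N N' n P = (\<lambda>\<alpha> \<beta>. iterated_residue n (\<lambda>zs. P zs * (\<Prod>j<n. weight N N' \<alpha> \<beta> (zs ! j))))"

section \<open>Laurent polynomials in the \<open>z_j\<close> and \<open>1 - z_j\<close>, and the
  residue functional on them\<close>

type_synonym laurent_term = "complex \<times> (nat \<Rightarrow> int) \<times> (nat \<Rightarrow> int)"

definition term_eval :: "nat \<Rightarrow> laurent_term \<Rightarrow> complex list \<Rightarrow> complex" where
  "term_eval n x zs =
     fst x * (\<Prod>j<n. zs ! j powi fst (snd x) j * (1 - zs ! j) powi snd (snd x) j)"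

text \<open>The set \<open>S\<close> lists variables in which a pole at \<open>0\<close> is excluded.\<close>

definition laurent_terms :: "nat \<Rightarrow> nat set \<Rightarrow> (complex list \<Rightarrow> complex) \<Rightarrow> laurent_term list \<Rightarrow> bool" where
  "laurent_terms n S P xs \<longleftrightarrow> (\<forall>x\<in>set xs. \<forall>j\<in>S. fst (snd x) j \<ge> 0) \<and>
     (\<forall>zs\<in>generic n. P zs = (\<Sum>x\<leftarrow>xs. term_eval n x zs))"

definition laurent :: "nat \<Rightarrow> nat set \<Rightarrow> (complex list \<Rightarrow> complex) \<Rightarrow> bool" where
  "laurent n S P \<longleftrightarrow> (\<exists>xs. laurent_terms n S P xs)"

text \<open>Representations are not unique, as \<open>z + (1 - z) = 1\<close> shows, but the
  right-hand side is the same for all of them. Linearity, multiplicativity and vanishing of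
  \<open>Xi\<close> are read off from this formula.\<close>

lemma Xi_laurent_terms:
  assumes "laurent_terms n S P xs"
  shows "Xi N N' n P \<alpha> \<beta> = (\<Sum>x\<leftarrow>xs. fst x *
    (\<Prod>j<n. res_0_inf (basic N N' \<alpha> \<beta> (fst (snd x) j) (snd (snd x) j))))"
  unfolding Xi_def
proof (rule iterated_residue_sum_basic)
  fix zs assume "zs \<in> generic n"
  then have P: "P zs = (\<Sum>x\<leftarrow>xs. term_eval n x zs)"
    using assms by (auto simp: laurent_terms_def)
  have "term_eval n x zs * (\<Prod>j<n. weight N N' \<alpha> \<beta> (zs ! j)) =
    fst x * (\<Prod>j<n. basic N N' \<alpha> \<beta> (fst (snd x) j) (snd (snd x) j) (zs ! j))" for x
    by (simp add: term_eval_def basic_def prod.distrib)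
  then show "P zs * (\<Prod>j<n. weight N N' \<alpha> \<beta> (zs ! j)) =
    (\<Sum>x\<leftarrow>xs. fst x * (\<Prod>j<n. basic N N' \<alpha> \<beta> (fst (snd x) j) (snd (snd x) j) (zs ! j)))"
    unfolding P sum_list_mult_const[symmetric] by simp
qed

lemma laurent_cong:
  assumes "laurent n S P" and "\<And>zs. zs \<in> generic n \<Longrightarrow> Q zs = P zs"
  shows "laurent n S Q"
  using assms unfolding laurent_def laurent_terms_def by simp

lemma laurent_mono: "laurent n S P \<Longrightarrow> T \<subseteq> S \<Longrightarrow> laurent n T P"
  unfolding laurent_def laurent_terms_def by (erule exE, rule exI) auto

lemma Xi_cong:
  assumes "laurent n S P" and eq: "\<And>zs. zs \<in> generic n \<Longrightarrow> Q zs = P zs"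
  shows "Xi N N' n Q = Xi N N' n P"
proof -
  obtain xs where "laurent_terms n S P xs" using assms(1) by (auto simp: laurent_def)
  moreover from this have "laurent_terms n S Q xs" using eq by (simp add: laurent_terms_def)
  ultimately show ?thesis by (intro ext) (simp add: Xi_laurent_terms)
qed

lemma laurent_terms_add:
  assumes "laurent_terms n S P xs" "laurent_terms n S Q ys"
  shows "laurent_terms n S (\<lambda>zs. P zs + Q zs) (xs @ ys)"
  using assms unfolding laurent_terms_def by auto

lemma laurent_add:
  "laurent n S P \<Longrightarrow> laurent n S Q \<Longrightarrow> laurent n S (\<lambda>zs. P zs + Q zs)"
  unfolding laurent_def using laurent_terms_add by blast

lemma Xi_add:
  assumes "laurent n S P" "laurent n S Q"
  shows "Xi N N' n (\<lambda>zs. P zs + Q zs) = Xi N N' n P + Xi N N' n Q"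
proof -
  obtain xs ys where "laurent_terms n S P xs" "laurent_terms n S Q ys"
    using assms by (auto simp: laurent_def)
  note * = this laurent_terms_add[OF this]
  show ?thesis
    by (intro ext) (simp add: *[THEN Xi_laurent_terms])
qed

lemma laurent_const: "laurent n S (\<lambda>_. c)"
  unfolding laurent_def laurent_terms_def
  by (rule exI[of _ "[(c, \<lambda>_. 0, \<lambda>_. 0)]"]) (auto simp: term_eval_def)

lemma Xi_0: "Xi N N' n (\<lambda>_. 0) = 0"
proof -
  have "laurent_terms n {} (\<lambda>_. 0) []" by (auto simp: laurent_terms_def)
  then show ?thesis by (intro ext) (simp add: Xi_laurent_terms)
qed

lemma laurent_sum:
  "(\<And>i. i \<in> A \<Longrightarrow> laurent n S (P i)) \<Longrightarrow> laurent n S (\<lambda>zs. \<Sum>i\<in>A. P i zs)"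
  by (induction A rule: infinite_finite_induct) (auto intro: laurent_const laurent_add)

lemma Xi_sum:
  assumes "\<And>i. i \<in> A \<Longrightarrow> laurent n S (P i)"
  shows "Xi N N' n (\<lambda>zs. \<Sum>i\<in>A. P i zs) = (\<Sum>i\<in>A. Xi N N' n (P i))"
  using assms
proof (induction A rule: infinite_finite_induct)
  case (insert x A)
  have "Xi N N' n (\<lambda>zs. P x zs + (\<Sum>i\<in>A. P i zs)) = Xi N N' n (P x) + Xi N N' n (\<lambda>zs. \<Sum>i\<in>A. P i zs)"
    by (rule Xi_add[of _ S]) (use insert.prems in \<open>auto intro!: laurent_sum\<close>)
  then show ?case using insert by simp
qed (simp_all add: Xi_0)

definition term_mult :: "laurent_term \<Rightarrow> laurent_term \<Rightarrow> laurent_term" where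
  "term_mult x y = (fst x * fst y, (\<lambda>j. fst (snd x) j + fst (snd y) j), (\<lambda>j. snd (snd x) j + snd (snd y) j))"

lemma term_eval_mult:
  assumes "zs \<in> generic n"
  shows "term_eval n (term_mult x y) zs = term_eval n x zs * term_eval n y zs"
proof -
  have "zs ! j \<noteq> 0" "zs ! j \<noteq> 1" if "j < n" for j
    using generic_nth[OF assms that] by auto
  then have "(\<Prod>j<n. zs ! j powi (fst (snd x) j + fst (snd y) j) * (1 - zs ! j) powi (snd (snd x) j + snd (snd y) j))
     = (\<Prod>j<n. (zs ! j powi fst (snd x) j * (1 - zs ! j) powi snd (snd x) j) *
         (zs ! j powi fst (snd y) j * (1 - zs ! j) powi snd (snd y) j))"
    by (intro prod.cong) (auto simp: power_int_add)
  then show ?thesis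
    by (simp add: term_eval_def term_mult_def prod.distrib mult_ac)
qed

lemma laurent_mult:
  assumes "laurent n S P" "laurent n S Q"
  shows "laurent n S (\<lambda>zs. P zs * Q zs)"
proof -
  obtain xs ys where xs: "laurent_terms n S P xs" and ys: "laurent_terms n S Q ys"
    using assms by (auto simp: laurent_def)
  have "laurent_terms n S (\<lambda>zs. P zs * Q zs) (concat (map (\<lambda>x. map (term_mult x) ys) xs))"
    unfolding laurent_terms_def
  proof (intro conjI ballI)
    fix x j assume "x \<in> set (concat (map (\<lambda>x. map (term_mult x) ys) xs))" "j \<in> S"
    then show "fst (snd x) j \<ge> 0"
      using xs ys by (fastforce simp: laurent_terms_def term_mult_def)
  next
    fix zs assume zs: "zs \<in> generic n"
    have "sum_list (map (\<lambda>x. term_eval n x zs) (concat (map (\<lambda>x. map (term_mult x) ys) us)))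
      = (\<Sum>x\<leftarrow>us. term_eval n x zs) * (\<Sum>y\<leftarrow>ys. term_eval n y zs)" for us
      by (induction us) (simp_all add: term_eval_mult[OF zs] o_def sum_list_const_mult algebra_simps)
    then show "P zs * Q zs = sum_list (map (\<lambda>x. term_eval n x zs) (concat (map (\<lambda>x. map (term_mult x) ys) xs)))"
      using xs ys zs by (simp add: laurent_terms_def)
  qed
  then show ?thesis by (auto simp: laurent_def)
qed

lemma laurent_prod:
  "(\<And>i. i \<in> A \<Longrightarrow> laurent n S (P i)) \<Longrightarrow> laurent n S (\<lambda>zs. \<Prod>i\<in>A. P i zs)"
  by (induction A rule: infinite_finite_induct) (auto intro: laurent_const laurent_mult)

lemma laurent_nth_powi:
  assumes "i < n" "i \<in> S \<Longrightarrow> m \<ge> 0"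
  shows "laurent n S (\<lambda>zs. zs ! i powi m)"
  unfolding laurent_def laurent_terms_def
proof (intro exI[of _ "[(1, (\<lambda>j. if j = i then m else 0), \<lambda>_. 0)]"] conjI ballI)
  fix zs :: "complex list" assume "zs \<in> generic n"
  have "(\<Prod>j<n. zs ! j powi (if j = i then m else 0)) = (\<Prod>j<n. if j = i then zs ! j powi m else 1)"
    by (intro prod.cong) auto
  then show "zs ! i powi m = (\<Sum>x\<leftarrow>[(1, (\<lambda>j. if j = i then m else 0), \<lambda>_. 0)]. term_eval n x zs)"
    using assms(1) by (simp add: term_eval_def)
qed (use assms in auto)

lemma laurent_one_minus_powi:
  assumes "i < n"
  shows "laurent n S (\<lambda>zs. (1 - zs ! i) powi m)"
  unfolding laurent_def laurent_terms_def
proof (intro exI[of _ "[(1, \<lambda>_. 0, (\<lambda>j. if j = i then m else 0))]"] conjI ballI)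
  fix zs :: "complex list" assume "zs \<in> generic n"
  have "(\<Prod>j<n. (1 - zs ! j) powi (if j = i then m else 0)) = (\<Prod>j<n. if j = i then (1 - zs ! j) powi m else 1)"
    by (intro prod.cong) auto
  then show "(1 - zs ! i) powi m = (\<Sum>x\<leftarrow>[(1, \<lambda>_. 0, (\<lambda>j. if j = i then m else 0))]. term_eval n x zs)"
    using assms(1) by (simp add: term_eval_def)
qed auto

lemma laurent_minus: "laurent n S P \<Longrightarrow> laurent n S (\<lambda>zs. - P zs)"
  using laurent_mult[OF laurent_const[of n S "- 1"], of P] by simp

lemma laurent_diff:
  "laurent n S P \<Longrightarrow> laurent n S Q \<Longrightarrow> laurent n S (\<lambda>zs. P zs - Q zs)"
  using laurent_add[OF _ laurent_minus[of n S Q], of P] by simp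

lemma laurent_nth: "i < n \<Longrightarrow> laurent n S (\<lambda>zs. zs ! i)"
  using laurent_nth_powi[of i n S 1] by simp

lemma Xi_lmult:
  assumes "laurent n S P"
  shows "Xi N N' n (\<lambda>zs. c * P zs) \<alpha> \<beta> = c * Xi N N' n P \<alpha> \<beta>"
proof -
  obtain xs where xs: "laurent_terms n S P xs"
    using assms by (auto simp: laurent_def)
  then have "laurent_terms n S (\<lambda>zs. c * P zs) (map (\<lambda>x. (c * fst x, snd x)) xs)"
    by (auto simp: laurent_terms_def o_def term_eval_def sum_list_const_mult[symmetric] mult_ac)
  note * = xs this
  show ?thesis
    by (simp add: *[THEN Xi_laurent_terms] o_def sum_list_const_mult[symmetric] mult_ac)
qed

text \<open>Each factor \<open>inverse (1 - zs ! j)\<close> lowers the order at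
  \<open>z_j = \<infinity>\<close> by one, and \<open>P\<close> has no pole at
  \<open>z_j = 0\<close>. For large \<open>K\<close> the factor of variable \<open>j\<close> is thus
  0 in every term. The bound depends only on the exponents at \<open>j\<close> and on
  \<open>N\<close>, \<open>N'\<close>; hence it is uniform in \<alpha>, \<beta>, \<open>i\<close>
  and \<open>m\<close>, and \<open>m\<close> may grow with \<open>K\<close>.\<close>

lemma Xi_vanish:
  assumes "laurent n {j} P" "j < n"
  shows "\<exists>K0::nat. \<forall>K\<ge>K0. \<forall>i m. i < n \<longrightarrow> i \<noteq> j \<longrightarrow>
    Xi N N' n (\<lambda>zs. P zs * (1 - zs ! j) powi (- int K) * (1 - zs ! i) powi m) = 0"
proof -
  obtain xs where xs: "laurent_terms n {j} P xs"
    using assms by (auto simp: laurent_def)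
  \<comment> \<open>This is the least \<open>K\<close> for which lowering the exponent of
    \<open>1 - zs ! j\<close> by \<open>K\<close> meets the inequality of
    \<open>res_0_inf_basic_eq_0\<close>.\<close>
  define d where "d = (\<lambda>x::laurent_term. nat (fst (snd x) j + snd (snd x) j + 2 + 2 * int N' - int N))"
  \<comment> \<open>The inserted 0 makes the maximum meaningful for an empty list of terms.\<close>
  define K0 where "K0 = Max (insert 0 (d ` set xs))"
  have K0: "d x \<le> K0" if "x \<in> set xs" for x
    using that by (auto simp: K0_def)
  show ?thesis
  proof (intro exI[of _ K0] allI impI ext)
    fix K i m \<alpha> \<beta> assume K: "K \<ge> K0" and i: "i < n" "i \<noteq> j"
    let ?b = "\<lambda>x k. snd (snd x) k + (if k = j then - int K else if k = i then m else 0)"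
    define g :: "laurent_term \<Rightarrow> laurent_term" where "g = (\<lambda>x. (fst x, fst (snd x), ?b x))"
    have g: "term_eval n (g x) zs = term_eval n x zs * (1 - zs ! j) powi (- int K) * (1 - zs ! i) powi m"
      if "zs \<in> generic n" for x zs
    proof -
      have nz: "zs ! k \<noteq> 0" "zs ! k \<noteq> 1" if "k < n" for k
        using generic_nth[OF \<open>zs \<in> generic n\<close> that] by auto
      have "(\<Prod>k<n. zs ! k powi fst (snd x) k * (1 - zs ! k) powi ?b x k) =
        (\<Prod>k<n. (zs ! k powi fst (snd x) k * (1 - zs ! k) powi snd (snd x) k) *
           ((if k = j then (1 - zs ! k) powi (- int K) else 1) * (if k = i then (1 - zs ! k) powi m else 1)))"
        using nz i by (intro prod.cong refl) (auto simp: power_int_add power_int_diff power_int_minus divide_inverse)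
      also have "\<dots> = (\<Prod>k<n. zs ! k powi fst (snd x) k * (1 - zs ! k) powi snd (snd x) k)
          * ((1 - zs ! j) powi (- int K) * (1 - zs ! i) powi m)"
        using i assms(2) by (subst prod.distrib, subst (2) prod.distrib) simp
      finally show ?thesis by (simp add: term_eval_def g_def)
    qed
    have "laurent_terms n {j} (\<lambda>zs. P zs * (1 - zs ! j) powi (- int K) * (1 - zs ! i) powi m) (map g xs)"
      using xs g
      by (auto simp: laurent_terms_def o_def sum_list_mult_const[symmetric] mult.assoc)
        (force simp: g_def)
    then have "Xi N N' n (\<lambda>zs. P zs * (1 - zs ! j) powi (- int K) * (1 - zs ! i) powi m) \<alpha> \<beta> =
       (\<Sum>x\<leftarrow>map g xs. fst x * (\<Prod>j<n. res_0_inf (basic N N' \<alpha> \<beta> (fst (snd x) j) (snd (snd x) j))))"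
      by (rule Xi_laurent_terms)
    also have "\<dots> = (\<Sum>x\<leftarrow>map g xs. 0)"
    proof (intro arg_cong[of _ _ sum_list] map_cong refl)
      fix x assume "x \<in> set (map g xs)"
      then obtain y where y: "y \<in> set xs" "x = g y" by auto
      have "fst (snd x) j \<ge> 0" using xs y by (auto simp: laurent_terms_def g_def)
      moreover have "fst (snd x) j + snd (snd x) j + 2 + 2 * int N' \<le> int N"
        using K0[OF y(1)] K by (simp add: y g_def d_def)
      ultimately have "res_0_inf (basic N N' \<alpha> \<beta> (fst (snd x) j) (snd (snd x) j)) = 0"
        by (rule res_0_inf_basic_eq_0)
      then have "(\<Prod>j<n. res_0_inf (basic N N' \<alpha> \<beta> (fst (snd x) j) (snd (snd x) j))) = 0"
        using assms(2) by (intro prod_zero) auto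
      then show "fst x * (\<Prod>j<n. res_0_inf (basic N N' \<alpha> \<beta> (fst (snd x) j) (snd (snd x) j))) = 0"
        by simp
    qed
    also have "\<dots> = 0" by (induction xs) auto
    finally show "Xi N N' n (\<lambda>zs. P zs * (1 - zs ! j) powi (- int K) * (1 - zs ! i) powi m) \<alpha> \<beta> = 0 \<alpha> \<beta>"
      by simp
  qed
qed

lemma prod_lessThan_add:
  fixes f :: "nat \<Rightarrow> 'a::comm_monoid_mult"
  shows "(\<Prod>j<p + q. f j) = (\<Prod>j<p. f j) * (\<Prod>j<q. f (p + j))"
  by (induction q) (simp_all add: mult.assoc)

lemma generic_take_drop:
  assumes "zs \<in> generic (p + q)"
  shows "take p zs \<in> generic p" "drop p zs \<in> generic q"
  using assms by (auto simp: generic_def dest: in_set_takeD in_set_dropD)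

text \<open>The value of a term is a product over the variables, so terms in two disjoint blocks of
  variables factor once their exponents are concatenated.\<close>

lemma Xi_mult:
  assumes "laurent p {} P" "laurent q {} Q"
  shows "Xi N N' (p + q) (\<lambda>zs. P (take p zs) * Q (drop p zs)) = Xi N N' p P * Xi N N' q Q"
proof (intro ext)
  fix \<alpha> \<beta>
  obtain xs ys where xs: "laurent_terms p {} P xs" and ys: "laurent_terms q {} Q ys"
    using assms by (auto simp: laurent_def)
  define g :: "laurent_term \<Rightarrow> laurent_term \<Rightarrow> laurent_term" where
    "g = (\<lambda>x y. (fst x * fst y, (\<lambda>j. if j < p then fst (snd x) j else fst (snd y) (j - p)),
       (\<lambda>j. if j < p then snd (snd x) j else snd (snd y) (j - p))))"
  have g: "term_eval (p + q) (g x y) zs = term_eval p x (take p zs) * term_eval q y (drop p zs)"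
    if "zs \<in> generic (p + q)" for x y zs
    using that by (simp add: g_def term_eval_def prod_lessThan_add generic_def mult_ac)
  have "laurent_terms (p + q) {} (\<lambda>zs. P (take p zs) * Q (drop p zs)) (concat (map (\<lambda>x. map (g x) ys) xs))"
    unfolding laurent_terms_def
  proof (intro conjI ballI)
    fix zs assume zs: "zs \<in> generic (p + q)"
    have "sum_list (map (\<lambda>x. term_eval (p + q) x zs) (concat (map (\<lambda>x. map (g x) ys) us)))
      = (\<Sum>x\<leftarrow>us. term_eval p x (take p zs)) * (\<Sum>y\<leftarrow>ys. term_eval q y (drop p zs))" for us
      by (induction us) (simp_all add: g[OF zs] o_def sum_list_const_mult algebra_simps)
    then show "P (take p zs) * Q (drop p zs) = sum_list (map (\<lambda>x. term_eval (p + q) x zs) (concat (map (\<lambda>x. map (g x) ys) xs)))"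
      using xs ys generic_take_drop[OF zs] by (simp add: laurent_terms_def)
  qed auto
  then have "Xi N N' (p + q) (\<lambda>zs. P (take p zs) * Q (drop p zs)) \<alpha> \<beta> =
    (\<Sum>x\<leftarrow>concat (map (\<lambda>x. map (g x) ys) xs). fst x *
      (\<Prod>j<p + q. res_0_inf (basic N N' \<alpha> \<beta> (fst (snd x) j) (snd (snd x) j))))"
    by (rule Xi_laurent_terms)
  also have "\<dots> = (\<Sum>x\<leftarrow>xs. fst x * (\<Prod>j<p. res_0_inf (basic N N' \<alpha> \<beta> (fst (snd x) j) (snd (snd x) j)))) *
     (\<Sum>x\<leftarrow>ys. fst x * (\<Prod>j<q. res_0_inf (basic N N' \<alpha> \<beta> (fst (snd x) j) (snd (snd x) j))))"
    by (induction xs)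
      (simp_all add: g_def prod_lessThan_add o_def sum_list_const_mult[symmetric] algebra_simps)
  also have "\<dots> = Xi N N' p P \<alpha> \<beta> * Xi N N' q Q \<alpha> \<beta>"
    by (simp add: xs[THEN Xi_laurent_terms] ys[THEN Xi_laurent_terms])
  finally show "Xi N N' (p + q) (\<lambda>zs. P (take p zs) * Q (drop p zs)) \<alpha> \<beta> = (Xi N N' p P * Xi N N' q Q) \<alpha> \<beta>"
    by simp
qed

section \<open>Uniqueness of Laurent expansions\<close>

text \<open>A nonzero coefficient would make 0 an isolated zero of the sum, which is the zero
  function.\<close>

lemma powser_coeff_eq_0:
  fixes a :: "nat \<Rightarrow> complex"
  assumes r: "0 < r" and s: "\<And>x. norm x < r \<Longrightarrow> (\<lambda>n. a n * x ^ n) sums 0"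
  shows "a n = 0"
proof (rule ccontr)
  assume nz: "a n \<noteq> 0"
  have "a 0 = 0" using s[of 0] r by simp
  with nz have "n > 0" by (cases n) auto
  obtain e where e: "0 < e" "\<And>z. z \<in> cball 0 e - {0::complex} \<Longrightarrow> (0::complex) \<noteq> 0"
    by (rule powser_0_nonzero[of r 0 a "\<lambda>_. 0" n]) (use r s nz \<open>n > 0\<close> in auto)
  have "complex_of_real e \<in> cball 0 e - {0}" using e(1) by simp
  then show False using e(2) by blast
qed

text \<open>Split the series as \<open>g z + H (1 / z) = 0\<close> into its nonnegative and negative
  powers. The series for \<open>H\<close> converges everywhere, and \<open>H w = - g (1 / w)\<close>
  tends to \<open>- g 0\<close> at infinity. By Liouville \<open>H\<close> is constant, equal to
  \<open>H 0 = 0\<close>, and then \<open>g\<close> vanishes too.\<close>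

lemma laurent_series_1_eq_0:
  fixes a :: "int \<Rightarrow> complex"
  assumes r: "0 < r"
    and s: "\<And>z. z \<noteq> 0 \<Longrightarrow> norm z < r \<Longrightarrow> ((\<lambda>k. a k * z powi k) has_sum 0) UNIV"
  shows "a k = 0"
proof -
  \<comment> \<open>The value \<open>b 0 = 0\<close> is what gives \<open>H 0 = 0\<close> after
    Liouville.\<close>
  define b :: "nat \<Rightarrow> complex" where "b = (\<lambda>n. if n = 0 then 0 else a (- int n))"
  have split: "\<exists>x. (\<lambda>n. a (int n) * z ^ n) sums x \<and> (\<lambda>n. b n * (1 / z) ^ n) sums (- x)"
    if z: "z \<noteq> 0" "norm z < r" for z
  proof -
    let ?f = "\<lambda>k. a k * z powi k"
    have sm: "?f summable_on X" for X
      using s[OF z] by (meson has_sum_imp_summable summable_on_subset subset_UNIV)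
    obtain x where x: "(?f has_sum x) {0..}" using sm by (auto simp: summable_on_def)
    obtain y where y: "(?f has_sum y) {..<0}" using sm by (auto simp: summable_on_def)
    have "(?f has_sum (x + y)) ({0..} \<union> {..<0})"
      using x y by (rule has_sum_Un_disjoint) auto
    moreover have "{0..} \<union> {..<0::int} = UNIV" by auto
    ultimately have xy: "x + y = 0" using s[OF z] has_sum_unique by metis
    have "(?f has_sum x) {0..} \<longleftrightarrow> ((\<lambda>n. a (int n) * z ^ n) has_sum x) UNIV"
      by (rule has_sum_reindex_bij_witness[of _ int nat]) (auto simp: power_int_def)
    with x have "((\<lambda>n. a (int n) * z ^ n) has_sum x) UNIV" by simp
    then have 1: "(\<lambda>n. a (int n) * z ^ n) sums x" by (rule has_sum_imp_sums)
    have "(?f has_sum y) {..<0} \<longleftrightarrow> ((\<lambda>n. b (Suc n) * (1 / z) ^ Suc n) has_sum y) UNIV"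
    proof (rule has_sum_reindex_bij_witness[of _ "\<lambda>n. - int (Suc n)" "\<lambda>k. nat (- k - 1)"])
      fix k :: int assume "k \<in> {..<0}"
      then have "k = - int (Suc (nat (- k - 1)))" by auto
      then obtain m where m: "k = - int (Suc m)" by blast
      then have *: "nat (- k - 1) = m" by simp
      show "b (Suc (nat (- k - 1))) * (1 / z) ^ Suc (nat (- k - 1)) = a k * z powi k"
        unfolding *
        by (simp only: m) (simp add: b_def power_int_minus power_one_over inverse_eq_divide flip: of_nat_Suc del: of_nat_Suc)
    qed auto
    with y have "((\<lambda>n. b (Suc n) * (1 / z) ^ Suc n) has_sum y) UNIV" by simp
    then have "(\<lambda>n. b (Suc n) * (1 / z) ^ Suc n) sums y" by (rule has_sum_imp_sums)
    then have "(\<lambda>n. b n * (1 / z) ^ n) sums y"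
      by (subst (asm) sums_Suc_iff) (simp add: b_def)
    moreover have "y = - x" using xy by (simp add: add_eq_0_iff)
    ultimately show ?thesis using 1 by blast
  qed
  \<comment> \<open>The point \<open>z = 1 / m\<close> may be taken arbitrarily close to 0, so the
    series in \<open>1 / z\<close> converges at arbitrarily large arguments.\<close>
  have bs: "summable (\<lambda>n. b n * w ^ n)" for w
  proof -
    obtain m :: real where m: "m > norm w" "m > 1 / r" using gt_ex[of "max (norm w) (1 / r)"] by auto
    have "m > 0" using m(2) r by (meson less_trans zero_less_divide_1_iff)
    then have "norm (complex_of_real (1 / m)) < r" "complex_of_real (1 / m) \<noteq> 0"
      using m r by (auto simp: norm_divide field_simps)
    from split[OF this(2,1)] have "summable (\<lambda>n. b n * (complex_of_real m) ^ n)"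
      by (auto simp: sums_iff)
    then show ?thesis
      by (rule powser_inside) (use m \<open>m > 0\<close> in auto)
  qed
  define H where "H = (\<lambda>w. \<Sum>n. b n * w ^ n)"
  define g where "g = (\<lambda>z. \<Sum>n. a (int n) * z ^ n)"
  have "H holomorphic_on UNIV"
    unfolding H_def using termdiffs_strong_converges_everywhere[OF bs]
    by (intro holomorphic_onI) (auto simp: field_differentiable_def intro: has_field_derivative_at_within)
  have Hg: "H (1 / z) = - g z" if "z \<noteq> 0" "norm z < r" for z
    using split[OF that] unfolding H_def g_def by (auto simp: sums_iff)
  have gs: "(\<lambda>n. a (int n) * z ^ n) sums g z" if "norm z < r" for z
  proof (cases "z = 0")
    case False
    then show ?thesis using split[OF False that] by (auto simp: g_def sums_iff)
  qed (simp add: g_def)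
  have "summable (\<lambda>n. a (int n) * (complex_of_real (r / 2)) ^ n)"
    using gs[of "complex_of_real (r / 2)"] r by (auto simp: sums_iff)
  then have "isCont g 0"
    unfolding g_def by (rule isCont_powser) (use r in auto)
  then have "((\<lambda>w. - g (inverse w)) \<longlongrightarrow> - g 0) at_infinity"
    by (intro tendsto_minus) (rule isCont_tendsto_compose[OF _ tendsto_inverse_0])
  moreover have "\<forall>\<^sub>F w in at_infinity. - g (inverse w) = H w"
  proof -
    have "\<forall>\<^sub>F w::complex in at_infinity. norm w \<ge> 1 / r + 1"
      unfolding eventually_at_infinity by blast
    then show ?thesis
    proof eventually_elim
      case (elim w)
      then have w: "norm w > 1 / r" by simp
      moreover have "1 / r > 0" using r by simp
      ultimately have w: "norm w > 1 / r" "w \<noteq> 0" by auto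
      then have "norm (inverse w) < r"
        using r by (simp add: norm_divide field_simps)
      then have "H (1 / inverse w) = - g (inverse w)" using w by (intro Hg) auto
      then show ?case by (simp add: divide_inverse)
    qed
  qed
  ultimately have "(H \<longlongrightarrow> - g 0) at_infinity"
    by (rule Lim_transform_eventually)
  then have H: "H w = - g 0" for w
    using \<open>H holomorphic_on UNIV\<close> by (rule Liouville_weak[rotated])
  have "H 0 = 0" unfolding H_def by (simp add: b_def)
  then have g0: "g 0 = 0" and H0: "H w = 0" for w using H by auto
  have b0: "b n = 0" for n
    using bs H0 by (intro powser_coeff_eq_0[of 1]) (auto simp: H_def sums_iff)
  have a0: "a (int n) = 0" for n
  proof (rule powser_coeff_eq_0[OF r])
    fix z :: complex assume z: "norm z < r"
    then have "g z = 0" using Hg[OF _ z] H0 g0 by (cases "z = 0") auto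
    then show "(\<lambda>n. a (int n) * z ^ n) sums 0" using gs[OF z] by simp
  qed
  show "a k = 0"
    by (cases k rule: int_cases) (use a0 b0[of "Suc _"] in \<open>auto simp: b_def\<close>)
qed

lemma lists_Suc_eq: "{e. length e = Suc n} = (\<lambda>(k, e). k # e) ` (UNIV \<times> {e. length e = n})"
  by (auto simp: length_Suc_conv image_iff)

lemma monomial_Cons: "monomial (z # t) (k # e) = z powi k * monomial t e"
  unfolding monomial_def by (simp only: length_Cons prod.lessThan_Suc_shift) simp

text \<open>With the larger variables \<open>t\<close> fixed, the first variable \<open>z\<close>
  ranges over a punctured disc. Grouping by powers of \<open>z\<close> and applying the one-variable
  case shows that each coefficient, a series in \<open>t\<close>, sums to 0; induction then applies
  to these series.\<close>

lemma laurent_series_eq_0: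
  fixes d :: "int list \<Rightarrow> complex"
  assumes "\<And>t. length t = n \<Longrightarrow> 0 \<notin> set t \<Longrightarrow> sorted_wrt (\<lambda>x y. norm x < norm y) t \<Longrightarrow>
      ((\<lambda>e. d e * monomial t e) has_sum 0) {e. length e = n}"
    and "length e = n"
  shows "d e = 0"
  using assms
proof (induction n arbitrary: d e)
  case 0
  have "((\<lambda>e. d e * monomial [] e) has_sum 0) {e. length e = 0}"
    using "0.prems"(1)[of "[]"] by simp
  then have "((\<lambda>e. d e * monomial [] e) has_sum 0) {[]}" by simp
  then have "d [] * monomial [] [] = 0"
    using has_sum_finite[of "{[]}" "\<lambda>e. d e * monomial [] e"] has_sum_unique by force
  then show ?case using "0.prems"(2) by (simp add: monomial_def)
next
  case (Suc n)
  obtain k e' where e: "e = k # e'" "length e' = n" using Suc.prems(2) by (cases e) auto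
  have "((\<lambda>e. d (k # e) * monomial t e) has_sum 0) {e. length e = n}"
    if t: "length t = n" "0 \<notin> set t" "sorted_wrt (\<lambda>x y. norm x < norm y) t" for t
  proof -
    \<comment> \<open>The ordering of norms only asks that \<open>z\<close> be smaller than the
      first entry of \<open>t\<close>; without further variables any radius will do.\<close>
    define r where "r = (if t = [] then 1 else norm (hd t))"
    have r: "0 < r" using t(2) by (cases t) (auto simp: r_def)
    have S: "((\<lambda>(k, e). d (k # e) * (z powi k * monomial t e)) has_sum 0) (UNIV \<times> {e. length e = n})"
      if z: "z \<noteq> 0" "norm z < r" for z
    proof -
      have "norm z < norm x" if "x \<in> set t" for x
        using that t(3) z(2) by (cases t) (auto simp: r_def)
      then have "((\<lambda>e. d e * monomial (z # t) e) has_sum 0) {e. length e = Suc n}"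
        using t z by (intro Suc.prems(1)) auto
      then show ?thesis
        unfolding lists_Suc_eq
        by (subst (asm) has_sum_reindex) (auto simp: inj_on_def o_def case_prod_unfold monomial_Cons)
    qed
    have sm: "(\<lambda>e. d (k # e) * monomial t e) summable_on {e. length e = n}" for k
    proof -
      \<comment> \<open>Any admissible \<open>z\<close> will do: the slice with power
        \<open>k\<close> inherits summability, and the nonzero factor \<open>z powi k\<close> can be
        divided out.\<close>
      define z where "z = complex_of_real (r / 2)"
      have z: "z \<noteq> 0" "norm z < r" using r by (auto simp: z_def)
      have "(\<lambda>(k, e). d (k # e) * (z powi k * monomial t e)) summable_on (UNIV \<times> {e. length e = n})"
        using S[OF z] by (rule has_sum_imp_summable)
      from summable_on_SigmaD1[OF this, of k]
      have "(\<lambda>e. d (k # e) * (z powi k * monomial t e)) summable_on {e. length e = n}" by simp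
      then have "(\<lambda>e. z powi k * (d (k # e) * monomial t e)) summable_on {e. length e = n}"
        by (simp add: mult_ac)
      then show ?thesis
        using z by (subst (asm) summable_on_cmult_right') auto
    qed
    define D where "D = (\<lambda>k. \<Sum>\<^sub>\<infinity>e\<in>{e. length e = n}. d (k # e) * monomial t e)"
    have D: "((\<lambda>e. d (k # e) * monomial t e) has_sum D k) {e. length e = n}" for k
      unfolding D_def using sm by (rule has_sum_infsum)
    have "D k = 0"
    proof (rule laurent_series_1_eq_0[OF r])
      fix z :: complex assume z: "z \<noteq> 0" "norm z < r"
      show "((\<lambda>k. D k * z powi k) has_sum 0) UNIV"
      proof (rule has_sum_SigmaD[OF S[OF z]])
        fix k
        show "((\<lambda>e. case (k, e) of (k, e) \<Rightarrow> d (k # e) * (z powi k * monomial t e)) has_sum D k * z powi k)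
            {e. length e = n}"
          using has_sum_cmult_left[OF D[of k], of "z powi k"] by (simp add: mult_ac)
      qed
    qed
    then show ?thesis using D[of k] by simp
  qed
  from Suc.IH[OF this e(2)] show ?case by (simp add: e)
qed

lemma is_laurent_expansion_unique:
  assumes "is_laurent_expansion n R c" "is_laurent_expansion n R c'"
  shows "c = c'"
proof
  fix e
  show "c e = c' e"
  proof (cases "length e = n")
    case True
    have "complex_of_int (c e) - of_int (c' e) = 0"
    proof (rule laurent_series_eq_0[OF _ True])
      fix t :: "complex list"
      assume t: "length t = n" "0 \<notin> set t" "sorted_wrt (\<lambda>x y. norm x < norm y) t"
      then have "((\<lambda>e. of_int (c e) * monomial t e) has_sum R t) {e. length e = n}"
        "((\<lambda>e. of_int (c' e) * monomial t e) has_sum R t) {e. length e = n}"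
        using assms by (auto simp: is_laurent_expansion_def)
      from has_sum_add[OF this(1) has_sum_uminusI[OF this(2)]]
      show "((\<lambda>e. (of_int (c e) - of_int (c' e)) * monomial t e) has_sum 0) {e. length e = n}"
        by (simp add: left_diff_distrib)
    qed
    then show ?thesis by simp
  qed (use assms in \<open>auto simp: is_laurent_expansion_def\<close>)
qed

text \<open>Both choices in \<open>has_groth_value\<close>, the expansion and the iterated sum, are
  forced; this makes the description in \<open>groth_op\<close> proper.\<close>

lemma has_groth_value_unique:
  assumes "has_groth_value N N' n R s" "has_groth_value N N' n R s'"
  shows "s = s'"
proof -
  obtain c c' where c: "is_laurent_expansion n R c"
      "has_iterated_sum n (\<lambda>e. of_int (c e) * grothendieck N N' e) s"
    and c': "is_laurent_expansion n R c'"
      "has_iterated_sum n (\<lambda>e. of_int (c' e) * grothendieck N N' e) s'"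
    using assms by (auto simp: has_groth_value_def)
  have "c = c'" using c(1) c'(1) by (rule is_laurent_expansion_unique)
  then show ?thesis using has_iterated_sum_unique c(2) c'(2) by blast
qed

section \<open>Partial fractions of the kernel\<close>

definition geometric_fps :: "complex \<Rightarrow> complex fps" where
  "geometric_fps x = Abs_fps (\<lambda>k. x ^ k)"

lemma geometric_fps_mult: "geometric_fps x * (1 - fps_const x * fps_X) = 1"
proof -
  have "geometric_fps x * (1 - fps_const x * fps_X) = geometric_fps x - fps_const x * (geometric_fps x * fps_X)"
    by (simp add: algebra_simps)
  also have "\<dots> = 1"
  proof (rule fps_ext)
    fix n
    show "(geometric_fps x - fps_const x * (geometric_fps x * fps_X)) $ n = 1 $ n"
      by (cases n) (simp_all add: geometric_fps_def)
  qed
  finally show ?thesis .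
qed

text \<open>The factor of \<open>mult_kernel\<close> belonging to one \<open>t_i\<close>, expanded
  formally in \<open>t_i\<close>, with \<open>s l\<close> standing for
  \<open>t_{p+l}\<close>.\<close>

definition kernel_fps :: "nat \<Rightarrow> (nat \<Rightarrow> complex) \<Rightarrow> complex fps" where
  "kernel_fps q s = (1 - fps_X) ^ q * (\<Prod>l<q. geometric_fps (inverse (s l)))"

text \<open>The value at \<open>t = s j\<close> of the kernel with its factor
  \<open>1 - t / s j\<close> removed, hence the coefficient of
  \<open>(t / s j) / (1 - t / s j)\<close> in the partial fraction decomposition.\<close>

definition kernel_residue :: "nat \<Rightarrow> (nat \<Rightarrow> complex) \<Rightarrow> nat \<Rightarrow> complex" where
  "kernel_residue q s j = (1 - s j) ^ q * (\<Prod>i\<in>{..<q} - {j}. s i / (s i - s j))"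

text \<open>This is the decomposition with denominators cleared. Both sides have degree at most
  \<open>q\<close> and agree at the \<open>q + 1\<close> distinct points 0 and \<open>s m\<close>:
  at 0 the factor \<open>t\<close> kills the sum, and at \<open>s m\<close> only the summand
  \<open>j = m\<close> survives.\<close>

lemma kernel_partial_fractions:
  assumes inj: "inj_on s {..<q}" and nz: "\<And>l. l < q \<Longrightarrow> s l \<noteq> 0"
  shows "[:1, -1:] ^ q = (\<Prod>l<q. [:1, - inverse (s l):]) +
    (\<Sum>j<q. smult (kernel_residue q s j * inverse (s j))
       ([:0, 1:] * (\<Prod>i\<in>{..<q} - {j}. [:1, - inverse (s i):])))" (is "?l = ?P + ?S")
proof (rule poly_eqI_degree)
  let ?A = "insert 0 (s ` {..<q})"
  have "0 \<notin> s ` {..<q}" using nz by force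
  then have card: "card ?A = Suc q" using inj by (simp add: card_image)
  have deg: "degree (\<Prod>i\<in>X. [:1, - inverse (s i):]) \<le> card X" for X
  proof -
    have "degree (\<Prod>i\<in>X. [:1, - inverse (s i):]) \<le> (\<Sum>i\<in>X. degree [:1, - inverse (s i):])"
      by (cases "finite X") (auto intro: degree_prod_sum_le[unfolded o_def] simp del: degree_pCons_eq_if)
    also have "\<dots> \<le> (\<Sum>i\<in>X. 1)" by (intro sum_mono) simp
    finally show ?thesis by simp
  qed
  have "degree ?l \<le> degree [:1, - 1 :: complex:] * q" by (rule degree_power_le)
  then show "card ?A > degree ?l" unfolding card by simp
  have "degree ?S \<le> q"
  proof (rule degree_sum_le)
    fix j assume j: "j \<in> {..<q}"
    have "degree (smult (kernel_residue q s j * inverse (s j))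
        ([:0, 1:] * (\<Prod>i\<in>{..<q} - {j}. [:1, - inverse (s i):])))
      \<le> degree ([:0, 1:] * (\<Prod>i\<in>{..<q} - {j}. [:1, - inverse (s i):]))" by (rule degree_smult_le)
    also have "\<dots> \<le> degree [:0, 1 :: complex:] + degree (\<Prod>i\<in>{..<q} - {j}. [:1, - inverse (s i):])"
      by (rule degree_mult_le)
    also have "\<dots> \<le> 1 + (q - 1)"
      using deg[of "{..<q} - {j}"] j by (intro add_mono) auto
    also have "\<dots> \<le> q" using j by auto
    finally show "degree (smult (kernel_residue q s j * inverse (s j))
        ([:0, 1:] * (\<Prod>i\<in>{..<q} - {j}. [:1, - inverse (s i):]))) \<le> q" .
  qed auto
  moreover have "degree ?P \<le> q" using deg[of "{..<q}"] by simp
  ultimately have "degree (?P + ?S) \<le> q" by (intro degree_add_le)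
  then show "card ?A > degree (?P + ?S)" unfolding card by simp
  fix x assume "x \<in> ?A"
  then consider "x = 0" | m where "m < q" "x = s m" by auto
  then show "poly ?l x = poly (?P + ?S) x"
  proof cases
    case 1
    then show ?thesis by (simp add: poly_sum poly_prod)
  next
    case 2
    have P: "poly ?P x = 0"
      using 2 nz by (auto simp: poly_prod intro!: prod_zero bexI[of _ m])
    have "poly ?S x = (\<Sum>j<q. kernel_residue q s j * inverse (s j) *
        (s m * (\<Prod>i\<in>{..<q} - {j}. 1 - s m * inverse (s i))))"
      by (simp add: poly_sum poly_prod 2(2) mult_ac)
    also have "\<dots> = (\<Sum>j<q. if j = m then (1 - s m) ^ q else 0)"
    proof (intro sum.cong refl)
      fix j assume j: "j \<in> {..<q}"
      show "kernel_residue q s j * inverse (s j) * (s m * (\<Prod>i\<in>{..<q} - {j}. 1 - s m * inverse (s i))) =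
         (if j = m then (1 - s m) ^ q else 0)"
      proof (cases "j = m")
        case True
        have "(\<Prod>i\<in>{..<q} - {m}. s i / (s i - s m)) * (\<Prod>i\<in>{..<q} - {m}. 1 - s m * inverse (s i))
          = (\<Prod>i\<in>{..<q} - {m}. 1)"
          unfolding prod.distrib[symmetric]
        proof (intro prod.cong refl)
          fix i assume i: "i \<in> {..<q} - {m}"
          then have "s i \<noteq> s m" using inj 2(1) by (auto dest: inj_onD)
          then show "s i / (s i - s m) * (1 - s m * inverse (s i)) = 1"
            using nz[of i] i by (simp add: field_simps)
        qed
        moreover have "kernel_residue q s m * inverse (s m) * (s m * (\<Prod>i\<in>{..<q} - {m}. 1 - s m * inverse (s i)))
          = (1 - s m) ^ q * ((\<Prod>i\<in>{..<q} - {m}. s i / (s i - s m)) *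
              (\<Prod>i\<in>{..<q} - {m}. 1 - s m * inverse (s i))) * (inverse (s m) * s m)"
          unfolding kernel_residue_def by (simp only: mult_ac)
        ultimately show ?thesis using True nz[OF 2(1)] by simp
      next
        case False
        then have "(\<Prod>i\<in>{..<q} - {j}. 1 - s m * inverse (s i)) = 0"
          using 2(1) nz by (intro prod_zero) (auto intro!: bexI[of _ m])
        then show ?thesis using False by simp
      qed
    qed
    also have "\<dots> = (1 - s m) ^ q" using 2(1) by simp
    finally show ?thesis using P by (simp add: 2(2))
  qed
qed

text \<open>Multiplying the polynomial identity by all geometric series clears the product in front
  and leaves one geometric series per summand. These carry a factor \<open>fps_X\<close>, whence the
  separate value at \<open>k = 0\<close>.\<close>

lemma kernel_fps_nth:
  assumes inj: "inj_on s {..<q}" and nz: "\<And>l. l < q \<Longrightarrow> s l \<noteq> 0"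
  shows "kernel_fps q s $ k = (if k = 0 then 1 else \<Sum>j<q. kernel_residue q s j * inverse (s j) ^ k)"
proof -
  let ?g = "\<lambda>l. geometric_fps (inverse (s l))" and ?d = "\<lambda>l. 1 - fps_const (inverse (s l)) * fps_X"
  let ?G = "\<Prod>l<q. ?g l"
  have d: "fps_of_poly [:1, - inverse (s l):] = ?d l" for l
    by (simp add: fps_of_poly_pCons)
  have e: "fps_of_poly [:1, -1:] = 1 - (fps_X :: complex fps)"
    by (simp add: fps_of_poly_pCons flip: fps_const_neg)
  have gd: "(\<Prod>l\<in>A. ?d l) * (\<Prod>l\<in>A. ?g l) = 1" for A
    by (subst mult.commute) (simp add: geometric_fps_mult flip: prod.distrib)
  have "fps_of_poly ([:1, -1:] ^ q) = fps_of_poly ((\<Prod>l<q. [:1, - inverse (s l):]) +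
    (\<Sum>j<q. smult (kernel_residue q s j * inverse (s j))
       ([:0, 1:] * (\<Prod>i\<in>{..<q} - {j}. [:1, - inverse (s i):]))))"
    using kernel_partial_fractions[OF assms] by simp
  then have "(1 - fps_X) ^ q = (\<Prod>l<q. ?d l) +
    (\<Sum>j<q. fps_const (kernel_residue q s j * inverse (s j)) * (fps_X * (\<Prod>i\<in>{..<q} - {j}. ?d i)))"
    unfolding fps_of_poly_add fps_of_poly_sum fps_of_poly_smult fps_of_poly_mult fps_of_poly_prod
      fps_of_poly_power d e
    by (simp add: fps_of_poly_pCons)
  then have "kernel_fps q s = (\<Prod>l<q. ?d l) * ?G +
    (\<Sum>j<q. fps_const (kernel_residue q s j * inverse (s j)) * (fps_X * (\<Prod>i\<in>{..<q} - {j}. ?d i))) * ?G"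
    unfolding kernel_fps_def by (simp add: distrib_right)
  also have "\<dots> = 1 + (\<Sum>j<q. fps_const (kernel_residue q s j * inverse (s j)) * (fps_X * ?g j))"
  proof -
    have "(fps_X * (\<Prod>i\<in>{..<q} - {j}. ?d i)) * ?G = fps_X * ?g j" if "j < q" for j
    proof -
      have "?G = ?g j * (\<Prod>l\<in>{..<q} - {j}. ?g l)"
        using that by (intro prod.remove) auto
      then have "(fps_X * (\<Prod>i\<in>{..<q} - {j}. ?d i)) * ?G =
          fps_X * ?g j * ((\<Prod>i\<in>{..<q} - {j}. ?d i) * (\<Prod>l\<in>{..<q} - {j}. ?g l))"
        by (simp only: mult_ac)
      then show ?thesis unfolding gd by simp
    qed
    then show ?thesis
      unfolding gd sum_distrib_right by (simp add: mult.assoc)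
  qed
  finally show ?thesis
    by (cases k) (simp_all add: fps_sum_nth geometric_fps_def mult.assoc)
qed

text \<open>Each partial fraction is a geometric series with an explicit tail. The identity is
  algebraic and involves no convergence, so it holds at all the points that the residues see,
  including those where \<open>t\<close> is not small compared with \<open>s l\<close>.\<close>

lemma kernel_tail:
  assumes inj: "inj_on s {..<q}" and nz: "\<And>l. l < q \<Longrightarrow> s l \<noteq> 0" and t: "\<And>l. l < q \<Longrightarrow> t \<noteq> s l"
  shows "(1 - t) ^ q / (\<Prod>l<q. 1 - t * inverse (s l)) - (\<Sum>k\<le>K. kernel_fps q s $ k * t ^ k) =
    (\<Sum>j<q. kernel_residue q s j * (t * inverse (s j)) ^ Suc K / (1 - t * inverse (s j)))"
proof -
  let ?d = "\<lambda>l. 1 - t * inverse (s l)"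
  let ?B = "kernel_residue q s"
  have d0: "?d l \<noteq> 0" if "l < q" for l
    using nz[OF that] t[OF that] by (auto simp: field_simps)
  then have D0: "(\<Prod>l\<in>A. ?d l) \<noteq> 0" if "A \<subseteq> {..<q}" for A
    using that finite_subset[OF that] by (auto simp: subset_iff)
  have "poly ([:1, -1:] ^ q) t = poly ((\<Prod>l<q. [:1, - inverse (s l):]) +
    (\<Sum>j<q. smult (?B j * inverse (s j)) ([:0, 1:] * (\<Prod>i\<in>{..<q} - {j}. [:1, - inverse (s i):])))) t"
    using kernel_partial_fractions[OF assms(1,2)] by simp
  then have "(1 - t) ^ q = (\<Prod>l<q. ?d l) +
    (\<Sum>j<q. (?B j * inverse (s j)) * (t * (\<Prod>i\<in>{..<q} - {j}. ?d i)))"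
    by (simp add: poly_sum poly_prod mult_ac)
  then have "(1 - t) ^ q / (\<Prod>l<q. ?d l) = 1 +
    (\<Sum>j<q. (?B j * inverse (s j)) * (t * (\<Prod>i\<in>{..<q} - {j}. ?d i)) / (\<Prod>l<q. ?d l))"
    using D0[of "{..<q}"] by (simp add: add_divide_distrib sum_divide_distrib)
  also have "(\<Sum>j<q. (?B j * inverse (s j)) * (t * (\<Prod>i\<in>{..<q} - {j}. ?d i)) / (\<Prod>l<q. ?d l))
     = (\<Sum>j<q. ?B j * (t * inverse (s j) / ?d j))"
  proof (intro sum.cong refl)
    fix j assume j: "j \<in> {..<q}"
    have "(\<Prod>l<q. ?d l) = ?d j * (\<Prod>i\<in>{..<q} - {j}. ?d i)"
      using j by (intro prod.remove) auto
    then show "(?B j * inverse (s j)) * (t * (\<Prod>i\<in>{..<q} - {j}. ?d i)) / (\<Prod>l<q. ?d l)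
       = ?B j * (t * inverse (s j) / ?d j)"
      using D0[of "{..<q} - {j}"] d0[of j] j by (simp add: mult_ac)
  qed
  finally have C: "(1 - t) ^ q / (\<Prod>l<q. ?d l) = 1 + (\<Sum>j<q. ?B j * (t * inverse (s j) / ?d j))" .
  have S: "(\<Sum>k\<le>K. kernel_fps q s $ k * t ^ k) = 1 + (\<Sum>j<q. ?B j * (\<Sum>k=1..K. (t * inverse (s j)) ^ k))"
  proof -
    have "(\<Sum>k\<le>K. kernel_fps q s $ k * t ^ k) = 1 + (\<Sum>k=1..K. kernel_fps q s $ k * t ^ k)"
      using kernel_fps_nth[OF assms(1,2), of 0] by (simp add: atMost_atLeast0 sum.atLeast_Suc_atMost)
    also have "(\<Sum>k=1..K. kernel_fps q s $ k * t ^ k) = (\<Sum>k=1..K. \<Sum>j<q. ?B j * (t * inverse (s j)) ^ k)"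
      by (intro sum.cong) (auto simp: kernel_fps_nth[OF assms(1,2)] sum_distrib_left power_mult_distrib mult_ac)
    also have "\<dots> = (\<Sum>j<q. ?B j * (\<Sum>k=1..K. (t * inverse (s j)) ^ k))"
      by (subst sum.swap) (simp add: sum_distrib_left)
    finally show ?thesis .
  qed
  \<comment> \<open>The first fraction equals the full geometric series from exponent 1 on, so
    subtracting \<open>K\<close> terms leaves the tail starting at \<open>Suc K\<close>.\<close>
  have tel: "t * inverse (s j) / ?d j - (\<Sum>k=1..K. (t * inverse (s j)) ^ k) = (t * inverse (s j)) ^ Suc K / ?d j"
    if "j < q" for j
  proof -
    have "y / (1 - y) - (\<Sum>k=1..K. y ^ k) = y ^ Suc K / (1 - y)" if "1 - y \<noteq> 0" for y :: complex
      using that by (induction K) (simp_all add: field_simps)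
    then show ?thesis using d0[OF that] by blast
  qed
  have "(1 - t) ^ q / (\<Prod>l<q. ?d l) - (\<Sum>k\<le>K. kernel_fps q s $ k * t ^ k) =
    (\<Sum>j<q. ?B j * (t * inverse (s j) / ?d j - (\<Sum>k=1..K. (t * inverse (s j)) ^ k)))"
    unfolding C S by (simp only: sum_subtractf right_diff_distrib) simp
  also have "\<dots> = (\<Sum>j<q. ?B j * ((t * inverse (s j)) ^ Suc K / ?d j))"
    by (intro sum.cong refl arg_cong2[of _ _ _ _ "(*)"] tel) simp
  finally show ?thesis by simp
qed

text \<open>It isolates \<open>y j\<close>. The Vandermonde factors meeting \<open>y j\<close>
  cancel against the differences, leaving \<open>- 1 / y m\<close> for \<open>m < j\<close> and
  \<open>1 / y j\<close> for each later index. With \<open>y j ^ q\<close> and the factor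
  \<open>1 / y j\<close> the total power is \<open>q - (q - 1 - j) - 1 = j\<close>, so no pole at
  \<open>y j = 0\<close> remains.\<close>

lemma prod_split_vandermonde:
  fixes y :: "nat \<Rightarrow> complex"
  assumes inj: "inj_on y {..<q}" and nz: "\<And>l. l < q \<Longrightarrow> y l \<noteq> 0" and j: "j < q"
  shows "(\<Prod>l<q. \<Prod>m<l. 1 - y l / y m) * (\<Prod>i\<in>{..<q} - {j}. 1 / (y j - y i)) * y j ^ q * (\<Prod>l<q. 1 / y l) =
    y j ^ j * (\<Prod>m<j. - 1 / y m) * (\<Prod>l\<in>{..<q} - {j}. \<Prod>m\<in>{..<l} - {j}. 1 - y l / y m) *
      (\<Prod>l\<in>{..<q} - {j}. 1 / y l)"
proof -
  have ne: "y j \<noteq> y i" if "i < q" "i \<noteq> j" for i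
    using inj j that by (auto dest: inj_onD)
  let ?V = "\<Prod>l\<in>{..<q} - {j}. \<Prod>m\<in>{..<l} - {j}. 1 - y l / y m"
  have 1: "(\<Prod>l<q. \<Prod>m<l. 1 - y l / y m) =
     (\<Prod>m<j. 1 - y j / y m) * (\<Prod>l\<in>{..<q} - {j}. \<Prod>m<l. 1 - y l / y m)"
    using j by (intro prod.remove) auto
  have 2: "(\<Prod>l\<in>{..<q} - {j}. \<Prod>m<l. 1 - y l / y m) = (\<Prod>l\<in>{Suc j..<q}. 1 - y l / y j) * ?V"
  proof -
    have "(\<Prod>l\<in>{..<q} - {j}. \<Prod>m<l. 1 - y l / y m) =
      (\<Prod>l\<in>{..<q} - {j}. (if j < l then 1 - y l / y j else 1) * (\<Prod>m\<in>{..<l} - {j}. 1 - y l / y m))"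
    proof (intro prod.cong refl)
      fix l
      show "(\<Prod>m<l. 1 - y l / y m) = (if j < l then 1 - y l / y j else 1) * (\<Prod>m\<in>{..<l} - {j}. 1 - y l / y m)"
      proof (cases "j < l")
        case True
        then have "(\<Prod>m<l. 1 - y l / y m) = (1 - y l / y j) * (\<Prod>m\<in>{..<l} - {j}. 1 - y l / y m)"
          by (intro prod.remove) auto
        then show ?thesis using True by simp
      next
        case False
        then have "{..<l} - {j} = {..<l}" by auto
        then show ?thesis using False by simp
      qed
    qed
    also have "\<dots> = (\<Prod>l\<in>{..<q} - {j}. if j < l then 1 - y l / y j else 1) * ?V"
      by (rule prod.distrib)
    also have "(\<Prod>l\<in>{..<q} - {j}. if j < l then 1 - y l / y j else 1) =
        (\<Prod>l\<in>{Suc j..<q}. if j < l then 1 - y l / y j else 1)"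
      by (intro prod.mono_neutral_right) auto
    finally show ?thesis by simp
  qed
  have 3: "(\<Prod>i\<in>{..<q} - {j}. 1 / (y j - y i)) = (\<Prod>i<j. 1 / (y j - y i)) * (\<Prod>i\<in>{Suc j..<q}. 1 / (y j - y i))"
  proof -
    have eq: "{..<q} - {j} = {..<j} \<union> {Suc j..<q}" using j by auto
    show ?thesis unfolding eq by (rule prod.union_disjoint) auto
  qed
  have 4: "(\<Prod>m<j. 1 - y j / y m) * (\<Prod>i<j. 1 / (y j - y i)) = (\<Prod>m<j. - 1 / y m)"
    unfolding prod.distrib[symmetric]
  proof (intro prod.cong refl)
    fix m assume "m \<in> {..<j}"
    then show "(1 - y j / y m) * (1 / (y j - y m)) = - 1 / y m"
      using ne[of m] nz[of m] j by (simp add: field_simps)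
  qed
  have 5: "(\<Prod>l\<in>{Suc j..<q}. 1 - y l / y j) * (\<Prod>i\<in>{Suc j..<q}. 1 / (y j - y i)) = (1 / y j) ^ (q - Suc j)"
  proof -
    have "(\<Prod>l\<in>{Suc j..<q}. (1 - y l / y j) * (1 / (y j - y l))) = (\<Prod>l\<in>{Suc j..<q}. 1 / y j)"
    proof (intro prod.cong refl)
      fix m assume "m \<in> {Suc j..<q}"
      then show "(1 - y m / y j) * (1 / (y j - y m)) = 1 / y j"
        using ne[of m] nz[of j] j by (simp add: field_simps)
    qed
    then show ?thesis by (simp only: prod.distrib prod_constant card_atLeastLessThan)
  qed
  have 6: "(\<Prod>l<q. 1 / y l) = 1 / y j * (\<Prod>l\<in>{..<q} - {j}. 1 / y l)"
    using j by (intro prod.remove) auto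
  have 7: "(1 / y j) ^ (q - Suc j) * y j ^ q * (1 / y j) = y j ^ j"
  proof -
    have "y j ^ q = y j ^ (q - Suc j) * y j ^ j * y j"
      using j by (simp flip: power_add power_Suc2)
    then show ?thesis using nz[OF j] by (simp add: power_one_over)
  qed
  have "(\<Prod>l<q. \<Prod>m<l. 1 - y l / y m) * (\<Prod>i\<in>{..<q} - {j}. 1 / (y j - y i)) * y j ^ q * (\<Prod>l<q. 1 / y l) =
     ((\<Prod>m<j. 1 - y j / y m) * (\<Prod>i<j. 1 / (y j - y i))) *
     ((\<Prod>l\<in>{Suc j..<q}. 1 - y l / y j) * (\<Prod>i\<in>{Suc j..<q}. 1 / (y j - y i))) * ?V * y j ^ q *
     (1 / y j * (\<Prod>l\<in>{..<q} - {j}. 1 / y l))"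
    unfolding 1 2 3 6 by (simp only: mult_ac)
  also have "\<dots> = ((1 / y j) ^ (q - Suc j) * y j ^ q * (1 / y j)) * (\<Prod>m<j. - 1 / y m) * ?V * (\<Prod>l\<in>{..<q} - {j}. 1 / y l)"
    unfolding 4 5 by (simp only: mult_ac)
  finally show ?thesis unfolding 7 .
qed

section \<open>Expanding the kernel in one variable\<close>

lemma iterated_residue_cong:
  "(\<And>zs. length zs = n \<Longrightarrow> f zs = g zs) \<Longrightarrow> iterated_residue n f = iterated_residue n g"
proof (induction n arbitrary: f g)
  case (Suc n)
  have "(\<lambda>z. f (z # zs)) = (\<lambda>z. g (z # zs))" if "length zs = n" for zs
    using Suc.prems that by auto
  then show ?case
    unfolding iterated_residue.simps by (intro Suc.IH) simp
qed simp

text \<open>The integrand of a Grothendieck polynomial without the monomial in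
  \<open>t_j = 1 - z_j\<close> and without the weights. The \<open>+ 1\<close> accounts for
  positions being counted from 0.\<close>

definition groth_kernel :: "nat \<Rightarrow> complex list \<Rightarrow> complex" where
  "groth_kernel n zs = (\<Prod>j<n. (1 - zs ! j) powi (- (int j + 1)) * (1 / zs ! j)) *
     (\<Prod>j<n. \<Prod>i<j. 1 - zs ! j / zs ! i)"

lemma laurent_unit:
  assumes "i < n"
  shows "i \<notin> S \<Longrightarrow> laurent n S (\<lambda>zs. 1 / zs ! i)"
    and "laurent n S (\<lambda>zs. 1 - zs ! i)"
    and "laurent n S (\<lambda>zs. inverse (1 - zs ! i))"
  using laurent_nth_powi[of i n S "-1"] laurent_diff[OF laurent_const[of n S 1] laurent_nth[OF assms, of S]]
    laurent_one_minus_powi[OF assms, of S "-1"] assms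
  by (auto simp: power_int_minus inverse_eq_divide)

lemma laurent_one_minus_divide:
  assumes "i < n" "j < n" "i \<notin> S"
  shows "laurent n S (\<lambda>zs. 1 - zs ! j / zs ! i)"
  using laurent_diff[OF laurent_const[of n S 1] laurent_mult[OF laurent_nth[OF assms(2)] laurent_unit(1)[OF assms(1,3)]]]
  by simp

lemma laurent_groth_kernel: "laurent n {} (groth_kernel n)"
proof -
  have "laurent n {} (\<lambda>zs. (\<Prod>j<n. (1 - zs ! j) powi (- (int j + 1)) * (1 / zs ! j)) *
     (\<Prod>j<n. \<Prod>i<j. 1 - zs ! j / zs ! i))"
    by (intro laurent_mult laurent_prod laurent_one_minus_powi laurent_one_minus_divide laurent_unit) auto
  then show ?thesis by (simp add: groth_kernel_def[abs_def])
qed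

text \<open>It turns a finite combination of \<open>t^e\<close> into the same combination of
  integrands, so that linearity of \<open>Xi\<close> yields linearity in \<open>t\<close>.\<close>

lemma grothendieck_eq_Xi:
  assumes "length e = n"
  shows "grothendieck N N' e = Xi N N' n (\<lambda>zs. (\<Prod>j<n. (1 - zs ! j) powi (e ! j)) * groth_kernel n zs)"
proof (intro ext)
  fix \<alpha> \<beta>
  let ?P = "\<lambda>zs. (\<Prod>j<n. (1 - zs ! j) powi (e ! j - (int j + 1))) *
       ((\<Prod>j<n. 1 / zs ! j) * (\<Prod>j<n. \<Prod>i<j. 1 - zs ! j / zs ! i))"
  have "grothendieck N N' e \<alpha> \<beta> = Xi N N' n ?P \<alpha> \<beta>"
    unfolding grothendieck_def Xi_def assms
    by (intro iterated_residue_cong) (simp add: kappa_def weight_def prod.distrib prod_dividef mult_ac)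
  also have "\<dots> = Xi N N' n (\<lambda>zs. (\<Prod>j<n. (1 - zs ! j) powi (e ! j)) * groth_kernel n zs) \<alpha> \<beta>"
  proof (rule fun_cong[OF fun_cong[OF Xi_cong[of n "{}"]]])
    show "laurent n {} (\<lambda>zs. (\<Prod>j<n. (1 - zs ! j) powi (e ! j)) * groth_kernel n zs)"
      by (intro laurent_mult laurent_prod laurent_one_minus_powi laurent_groth_kernel) auto
    fix zs assume zs: "zs \<in> generic n"
    \<comment> \<open>Splitting the exponent requires \<open>zs ! j \<noteq> 1\<close>; for this
      reason the equation is used on generic lists only.\<close>
    have "(\<Prod>j<n. (1 - zs ! j) powi (e ! j - (int j + 1))) =
       (\<Prod>j<n. (1 - zs ! j) powi (e ! j) * (1 - zs ! j) powi (- (int j + 1)))"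
    proof (intro prod.cong refl)
      fix j assume "j \<in> {..<n}"
      then have "1 - zs ! j \<noteq> 0" using generic_nth[OF zs, of j] by simp
      moreover have eq: "e ! j - (int j + 1) = e ! j + - (int j + 1)" by simp
      ultimately show "(1 - zs ! j) powi (e ! j - (int j + 1)) =
          (1 - zs ! j) powi (e ! j) * (1 - zs ! j) powi (- (int j + 1))"
        unfolding eq by (intro power_int_add) simp
    qed
    then show "?P zs = (\<Prod>j<n. (1 - zs ! j) powi (e ! j)) * groth_kernel n zs"
      unfolding groth_kernel_def prod.distrib by (simp only: mult_ac)
  qed
  finally show "grothendieck N N' e \<alpha> \<beta> =
    Xi N N' n (\<lambda>zs. (\<Prod>j<n. (1 - zs ! j) powi (e ! j)) * groth_kernel n zs) \<alpha> \<beta>" .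
qed

section \<open>Splitting the integrand along the two blocks of variables\<close>

definition tail :: "nat \<Rightarrow> complex list \<Rightarrow> nat \<Rightarrow> complex" where
  "tail p zs l = 1 - zs ! (p + l)"

definition kernel_coeff :: "nat \<Rightarrow> nat \<Rightarrow> complex list \<Rightarrow> int \<Rightarrow> complex" where
  "kernel_coeff p q zs m = (if m < 0 then 0 else fps_nth (kernel_fps q (tail p zs)) (nat m))"

text \<open>The Vandermonde factors that couple variable \<open>i\<close> of the first block to the
  second block; the closed form of the kernel cancels them.\<close>

definition cross :: "nat \<Rightarrow> nat \<Rightarrow> complex list \<Rightarrow> nat \<Rightarrow> complex" where
  "cross p q zs i = (\<Prod>l<q. 1 - zs ! (p + l) / zs ! i)"

text \<open>Kept apart from \<open>partial_base\<close> because it has poles at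
  \<open>y_l = 0\<close>, which disappear at \<open>l = j\<close> only together with
  \<open>kernel_residue\<close> for the index \<open>j\<close>.\<close>

definition tail_kernel :: "nat \<Rightarrow> nat \<Rightarrow> complex list \<Rightarrow> complex" where
  "tail_kernel p q zs = (\<Prod>l<q. 1 / zs ! (p + l)) * (\<Prod>l<q. \<Prod>m<l. 1 - zs ! (p + l) / zs ! (p + m))"

text \<open>Integrand with the kernel expanded in the first \<open>length k\<close> variables, where only the powers
  given by \<open>k\<close> are kept. In the variables with index in \<open>R\<close> the closed form of the kernel is used,
  after cancellation against \<^const>\<open>cross\<close>.\<close>

definition partial_base ::
    "nat \<Rightarrow> nat \<Rightarrow> int list \<Rightarrow> int list \<Rightarrow> int list \<Rightarrow> nat set \<Rightarrow> complex list \<Rightarrow> complex" where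
  "partial_base p q I J k R zs =
     (\<Prod>i<length k. (1 - zs ! i) powi (k ! i) * kernel_coeff p q zs (k ! i - I ! i) * cross p q zs i) *
     (\<Prod>i\<in>R. (1 - zs ! i) powi (I ! i) * (\<Prod>l<q. tail p zs l)) *
     (\<Prod>l<q. tail p zs l powi (J ! l)) * groth_kernel p zs *
     (\<Prod>l<q. tail p zs l powi (- (int (p + l) + 1)))"

definition partial_integrand ::
    "nat \<Rightarrow> nat \<Rightarrow> int list \<Rightarrow> int list \<Rightarrow> int list \<Rightarrow> complex list \<Rightarrow> complex" where
  "partial_integrand p q I J k zs = partial_base p q I J k {length k..<p} zs * tail_kernel p q zs"

lemma groth_kernel_split:
  "groth_kernel (p + q) zs = groth_kernel p zs * (\<Prod>l<q. tail p zs l powi (- (int (p + l) + 1))) *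
     (\<Prod>i<p. cross p q zs i) * tail_kernel p q zs"
proof -
  have "(\<Prod>l<q. \<Prod>i<p. 1 - zs ! (p + l) / zs ! i) = (\<Prod>i<p. cross p q zs i)"
    unfolding cross_def by (rule prod.swap)
  then show ?thesis
    unfolding groth_kernel_def tail_kernel_def tail_def prod_lessThan_add prod.distrib
    by (simp only: mult_ac)
qed

text \<open>Once all variables of the first block are expanded, the cross factors reassemble
  \<open>groth_kernel (p + q)\<close>, and the middle factor is the coefficient of
  \<open>t^k\<close> in the series, a Laurent polynomial in the \<open>s_l\<close>.\<close>

lemma partial_integrand_full:
  assumes "length k = p"
  shows "partial_integrand p q I J k zs =
    (\<Prod>i<p. (1 - zs ! i) powi (k ! i)) * ((\<Prod>l<q. tail p zs l powi (J ! l)) *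
      (\<Prod>i<p. kernel_coeff p q zs (k ! i - I ! i))) * groth_kernel (p + q) zs"
  unfolding partial_integrand_def partial_base_def groth_kernel_split assms
  by (simp add: prod.distrib mult_ac)

lemma laurent_fps_mult:
  assumes "\<And>k. laurent n S (\<lambda>zs. fps_nth (F zs) k)" "\<And>k. laurent n S (\<lambda>zs. fps_nth (G zs) k)"
  shows "laurent n S (\<lambda>zs. fps_nth (F zs * G zs) k)"
  unfolding fps_mult_nth by (intro laurent_sum laurent_mult assms)

lemma laurent_fps_prod:
  assumes "\<And>i k. i \<in> A \<Longrightarrow> laurent n S (\<lambda>zs. fps_nth (F i zs) k)"
  shows "laurent n S (\<lambda>zs. fps_nth (\<Prod>i\<in>A. F i zs) k)"
  using assms
proof (induction A arbitrary: k rule: infinite_finite_induct)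
  case (insert x A)
  then show ?case by (simp add: laurent_fps_mult)
qed (simp_all add: laurent_const)

lemma laurent_kernel_coeff: "laurent (p + q) S (\<lambda>zs. kernel_coeff p q zs m)"
proof (cases "m < 0")
  case False
  have "laurent (p + q) S (\<lambda>zs. fps_nth (kernel_fps q (tail p zs)) k)" for k
    unfolding kernel_fps_def
  proof (intro laurent_fps_mult laurent_fps_prod laurent_const)
    fix l k assume "l \<in> {..<q}"
    then show "laurent (p + q) S (\<lambda>zs. fps_nth (geometric_fps (inverse (tail p zs l))) k)"
      using laurent_one_minus_powi[of "p + l" "p + q" S "- int k"]
      by (simp add: geometric_fps_def tail_def power_int_minus power_inverse)
  qed
  with False show ?thesis by (simp add: kernel_coeff_def)
qed (simp add: kernel_coeff_def laurent_const)

lemma laurent_cross: "i < p \<Longrightarrow> i \<notin> S \<Longrightarrow> laurent (p + q) S (\<lambda>zs. cross p q zs i)"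
  unfolding cross_def by (intro laurent_prod laurent_one_minus_divide) auto

lemma laurent_tail_powi: "l < q \<Longrightarrow> laurent (p + q) S (\<lambda>zs. tail p zs l powi m)"
  unfolding tail_def by (intro laurent_one_minus_powi) auto

lemma laurent_tail: "l < q \<Longrightarrow> laurent (p + q) S (\<lambda>zs. tail p zs l)"
  using laurent_tail_powi[of l q p S 1] by simp

text \<open>Without \<open>tail_kernel\<close>, negative powers of \<open>z\<close> occur only in
  the first block, so \<open>S\<close> may contain any index of the second.\<close>

lemma laurent_partial_base:
  assumes "length k \<le> p" "R \<subseteq> {..<p}" "S \<inter> {..<p} = {}"
  shows "laurent (p + q) S (partial_base p q I J k R)"
proof -
  have "laurent (p + q) S (\<lambda>zs. partial_base p q I J k R zs)"
    unfolding partial_base_def groth_kernel_def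
    using assms
    by (intro laurent_mult laurent_prod laurent_one_minus_powi laurent_kernel_coeff laurent_cross
      laurent_tail laurent_tail_powi laurent_one_minus_divide laurent_unit(1)) auto
  then show ?thesis by simp
qed

lemma laurent_tail_kernel: "laurent (p + q) {} (tail_kernel p q)"
proof -
  have "laurent (p + q) {} (\<lambda>zs. tail_kernel p q zs)"
    unfolding tail_kernel_def
    by (intro laurent_mult laurent_prod laurent_one_minus_divide laurent_unit(1)) auto
  then show ?thesis by simp
qed

lemma laurent_partial_integrand:
  assumes "length k \<le> p"
  shows "laurent (p + q) {} (partial_integrand p q I J k)"
proof -
  have "laurent (p + q) {} (\<lambda>zs. partial_integrand p q I J k zs)"
    unfolding partial_integrand_def using assms
    by (intro laurent_mult laurent_partial_base laurent_tail_kernel) auto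
  then show ?thesis by simp
qed

lemma generic_tail:
  assumes zs: "zs \<in> generic (p + q)"
  shows "l < q \<Longrightarrow> tail p zs l \<noteq> 0" "inj_on (\<lambda>l. zs ! (p + l)) {..<q}" "inj_on (tail p zs) {..<q}"
    and "i < p \<Longrightarrow> l < q \<Longrightarrow> 1 - zs ! (p + l) / zs ! i \<noteq> 0"
    and "i < p \<Longrightarrow> l < q \<Longrightarrow>
      1 - (1 - zs ! i) * inverse (tail p zs l) = zs ! i * (1 - zs ! (p + l) / zs ! i) * inverse (tail p zs l)"
    and "i < p \<Longrightarrow> l < q \<Longrightarrow> 1 - zs ! i \<noteq> tail p zs l"
proof -
  show tl: "l < q \<Longrightarrow> tail p zs l \<noteq> 0" for l
    using generic_nth[OF zs, of "p + l"] by (simp add: tail_def)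
  show "inj_on (\<lambda>l. zs ! (p + l)) {..<q}" "inj_on (tail p zs) {..<q}"
    using zs by (auto intro!: inj_onI simp: generic_def tail_def nth_eq_iff_index_eq)
  have ne: "i < p \<Longrightarrow> l < q \<Longrightarrow> zs ! (p + l) \<noteq> zs ! i"
    using zs by (auto simp: generic_def nth_eq_iff_index_eq)
  have nz: "i < p \<Longrightarrow> zs ! i \<noteq> 0" using generic_nth[OF zs, of i] by simp
  show "i < p \<Longrightarrow> l < q \<Longrightarrow> 1 - zs ! (p + l) / zs ! i \<noteq> 0"
    using ne nz by simp
  show "i < p \<Longrightarrow> l < q \<Longrightarrow> 1 - zs ! i \<noteq> tail p zs l"
    using ne by (simp add: tail_def)
  show "i < p \<Longrightarrow> l < q \<Longrightarrow>
      1 - (1 - zs ! i) * inverse (tail p zs l) = zs ! i * (1 - zs ! (p + l) / zs ! i) * inverse (tail p zs l)"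
  proof -
    have "1 - (1 - a) * inverse (1 - b) = a * (1 - b / a) * inverse (1 - b)"
      if "a \<noteq> 0" "1 - b \<noteq> 0" for a b :: complex
    proof -
      have "a * (1 - b / a) = a - b" using that(1) by (simp add: right_diff_distrib)
      moreover have "(1 - b) * inverse (1 - b) = 1" using that(2) by simp
      then have "1 - (1 - a) * inverse (1 - b) = (a - b) * inverse (1 - b)" by algebra
      ultimately show ?thesis by simp
    qed
    then show "i < p \<Longrightarrow> l < q \<Longrightarrow>
      1 - (1 - zs ! i) * inverse (tail p zs l) = zs ! i * (1 - zs ! (p + l) / zs ! i) * inverse (tail p zs l)"
      using nz tl[of l] by (simp add: tail_def)
  qed
qed

text \<open>Since \<open>zs ! i\<close> is \<open>1 - t_i\<close>, the fraction is the factor of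
  \<open>mult_kernel\<close> for \<open>t_i\<close>. Its denominators \<open>1 - t_i / s_l\<close>
  equal \<open>z_i (1 - y_l / z_i) / s_l\<close>, and the cross product removes the middle
  part.\<close>

lemma kernel_times_cross:
  assumes zs: "zs \<in> generic (p + q)" and i: "i < p"
  shows "(zs ! i) ^ q / (\<Prod>l<q. 1 - (1 - zs ! i) * inverse (tail p zs l)) * cross p q zs i = (\<Prod>l<q. tail p zs l)"
proof -
  have "(\<Prod>l<q. 1 - (1 - zs ! i) * inverse (tail p zs l)) =
    (\<Prod>l<q. zs ! i * (1 - zs ! (p + l) / zs ! i) * inverse (tail p zs l))"
    using generic_tail(5)[OF zs i] by (intro prod.cong) auto
  also have "\<dots> = zs ! i ^ q * cross p q zs i * inverse (\<Prod>l<q. tail p zs l)"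
    by (simp add: prod.distrib cross_def prod_inversef[symmetric] o_def)
  finally have *: "(\<Prod>l<q. 1 - (1 - zs ! i) * inverse (tail p zs l)) = \<dots>" .
  have "zs ! i \<noteq> 0" using generic_nth[OF zs, of i] i by simp
  moreover have "\<forall>l\<in>{..<q}. 1 - zs ! (p + l) / zs ! i \<noteq> 0" using generic_tail(4)[OF zs i] by blast
  then have "cross p q zs i \<noteq> 0" by (simp only: cross_def prod_zero_iff finite_lessThan) blast
  moreover have "a / (a * c * inverse T) * c = T" if "a \<noteq> 0" "c \<noteq> 0" for a c T :: complex
    using that by (simp add: divide_inverse)
  ultimately show ?thesis unfolding * by simp
qed

text \<open>The denominator left over in the remainder contains \<open>1 - y_j / z_i\<close>, which
  is one of the factors of \<open>cross\<close>; after cancelling it only \<open>z_i = 0\<close> can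
  be a pole.\<close>

lemma laurent_cross_divide:
  assumes "i < p" "j < q"
  shows "laurent (p + q) {p + j} (\<lambda>zs. cross p q zs i / (1 - (1 - zs ! i) * inverse (tail p zs j)))"
proof (rule laurent_cong)
  show "laurent (p + q) {p + j} (\<lambda>zs. (\<Prod>l\<in>{..<q} - {j}. 1 - zs ! (p + l) / zs ! i) * (1 / zs ! i) * tail p zs j)"
    using assms by (intro laurent_mult laurent_prod laurent_one_minus_divide laurent_unit(1) laurent_tail) auto
  fix zs assume zs: "zs \<in> generic (p + q)"
  have "cross p q zs i = (1 - zs ! (p + j) / zs ! i) * (\<Prod>l\<in>{..<q} - {j}. 1 - zs ! (p + l) / zs ! i)"
    unfolding cross_def using assms by (intro prod.remove) auto
  then show "cross p q zs i / (1 - (1 - zs ! i) * inverse (tail p zs j)) =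
      (\<Prod>l\<in>{..<q} - {j}. 1 - zs ! (p + l) / zs ! i) * (1 / zs ! i) * tail p zs j"
    unfolding generic_tail(5)[OF zs assms]
    using generic_tail(1,4)[OF zs] assms by (simp add: divide_inverse mult_ac)
qed

text \<open>In the \<open>y\<close> variables \<open>1 - s_j\<close> is \<open>y_j\<close> and
  \<open>s_i - s_j\<close> is \<open>y_j - y_i\<close>, so \<open>prod_split_vandermonde\<close>
  applies.\<close>

lemma laurent_residue_tail_kernel:
  assumes "j < q"
  shows "laurent (p + q) {p + j} (\<lambda>zs. kernel_residue q (tail p zs) j * tail_kernel p q zs)"
proof (rule laurent_cong)
  show "laurent (p + q) {p + j} (\<lambda>zs. (zs ! (p + j) powi int j * (\<Prod>m<j. - (1 / zs ! (p + m))) *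
     (\<Prod>l\<in>{..<q} - {j}. \<Prod>m\<in>{..<l} - {j}. 1 - zs ! (p + l) / zs ! (p + m)) *
      (\<Prod>l\<in>{..<q} - {j}. 1 / zs ! (p + l))) * (\<Prod>l\<in>{..<q} - {j}. tail p zs l))"
    using assms
    by (intro laurent_mult laurent_prod laurent_one_minus_divide laurent_unit(1) laurent_tail laurent_minus
        laurent_nth_powi) auto
  fix zs assume zs: "zs \<in> generic (p + q)"
  have "kernel_residue q (tail p zs) j = zs ! (p + j) ^ q *
     ((\<Prod>i\<in>{..<q} - {j}. 1 / (zs ! (p + j) - zs ! (p + i))) * (\<Prod>l\<in>{..<q} - {j}. tail p zs l))"
    unfolding kernel_residue_def prod.distrib[symmetric] by (simp add: tail_def)
  then have "kernel_residue q (tail p zs) j * tail_kernel p q zs =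
     ((\<Prod>l<q. \<Prod>m<l. 1 - zs ! (p + l) / zs ! (p + m)) * (\<Prod>i\<in>{..<q} - {j}. 1 / (zs ! (p + j) - zs ! (p + i))) *
       zs ! (p + j) ^ q * (\<Prod>l<q. 1 / zs ! (p + l))) * (\<Prod>l\<in>{..<q} - {j}. tail p zs l)"
    unfolding tail_kernel_def by (simp only: mult_ac)
  also have "\<dots> = (zs ! (p + j) ^ j * (\<Prod>m<j. - 1 / zs ! (p + m)) *
     (\<Prod>l\<in>{..<q} - {j}. \<Prod>m\<in>{..<l} - {j}. 1 - zs ! (p + l) / zs ! (p + m)) *
      (\<Prod>l\<in>{..<q} - {j}. 1 / zs ! (p + l))) * (\<Prod>l\<in>{..<q} - {j}. tail p zs l)"
    by (subst prod_split_vandermonde[of "\<lambda>l. zs ! (p + l)"])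
      (use generic_tail(2)[OF zs] generic_nth[OF zs] assms in auto)
  finally show "kernel_residue q (tail p zs) j * tail_kernel p q zs =
    (zs ! (p + j) powi int j * (\<Prod>m<j. - (1 / zs ! (p + m))) *
     (\<Prod>l\<in>{..<q} - {j}. \<Prod>m\<in>{..<l} - {j}. 1 - zs ! (p + l) / zs ! (p + m)) *
      (\<Prod>l\<in>{..<q} - {j}. 1 / zs ! (p + l))) * (\<Prod>l\<in>{..<q} - {j}. tail p zs l)"
    by simp
qed

text \<open>The closed form in the next variable is replaced by its truncated series plus the
  remainder from \<open>kernel_tail\<close>. The remainder is arranged as a factor without pole at
  \<open>y_j = 0\<close> times powers of \<open>s_j\<close> and \<open>t\<close>, the shape that
  \<open>Xi_vanish\<close> expects.\<close>

lemma partial_integrand_step: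
  assumes zs: "zs \<in> generic (p + q)" and r: "length k < p"
  shows "partial_integrand p q I J k zs =
    (\<Sum>m\<le>K. partial_integrand p q I J (k @ [I ! length k + int m]) zs) +
    (\<Sum>j<q. partial_base p q I J k {Suc (length k)..<p} zs *
        (cross p q zs (length k) / (1 - (1 - zs ! length k) * inverse (tail p zs j))) *
        (1 - zs ! length k) powi (I ! length k) *
        (kernel_residue q (tail p zs) j * tail_kernel p q zs) *
        tail p zs j powi (- int (Suc K)) * (1 - zs ! length k) powi (int (Suc K)))"
proof -
  let ?r = "length k"
  let ?t = "1 - zs ! ?r"
  let ?s = "tail p zs"
  let ?C = "(1 - ?t) ^ q / (\<Prod>l<q. 1 - ?t * inverse (?s l))"
  let ?b = "partial_base p q I J k {Suc ?r..<p} zs" and ?c = "cross p q zs ?r" and ?V = "tail_kernel p q zs"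
  have t: "?t \<noteq> 0" using generic_nth[OF zs, of ?r] r by simp
  have "{?r..<p} = insert ?r {Suc ?r..<p}" using r by auto
  then have "partial_base p q I J k {?r..<p} zs = ?b * (?t powi (I ! ?r) * (\<Prod>l<q. ?s l))"
    by (simp add: partial_base_def mult_ac)
  then have 1: "partial_integrand p q I J k zs = ?b * ?c * ?t powi (I ! ?r) * ?V * ?C"
    unfolding partial_integrand_def kernel_times_cross[OF zs r, symmetric] by simp
  have "partial_base p q I J (k @ [m]) R zs = partial_base p q I J k R zs * (?t powi m * kernel_coeff p q zs (m - I ! ?r) * ?c)" for m R
    by (simp add: partial_base_def nth_append mult_ac)
  then have 2: "partial_integrand p q I J (k @ [I ! ?r + int m]) zs =
     ?b * ?c * ?t powi (I ! ?r) * ?V * (fps_nth (kernel_fps q ?s) m * ?t ^ m)" for m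
    using t by (simp add: partial_integrand_def kernel_coeff_def power_int_add)
  have "?C - (\<Sum>m\<le>K. fps_nth (kernel_fps q ?s) m * ?t ^ m) =
      (\<Sum>j<q. kernel_residue q ?s j * (?t * inverse (?s j)) ^ Suc K / (1 - ?t * inverse (?s j)))"
    using generic_tail[OF zs] r by (intro kernel_tail) auto
  then have "?C = (\<Sum>m\<le>K. fps_nth (kernel_fps q ?s) m * ?t ^ m) +
      (\<Sum>j<q. kernel_residue q ?s j * (?t * inverse (?s j)) ^ Suc K / (1 - ?t * inverse (?s j)))"
    by (simp add: algebra_simps)
  then have "partial_integrand p q I J k zs =
     (\<Sum>m\<le>K. ?b * ?c * ?t powi (I ! ?r) * ?V * (fps_nth (kernel_fps q ?s) m * ?t ^ m)) +
     (\<Sum>j<q. ?b * ?c * ?t powi (I ! ?r) * ?V *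
        (kernel_residue q ?s j * (?t * inverse (?s j)) ^ Suc K / (1 - ?t * inverse (?s j))))"
    unfolding 1 by (simp only: distrib_left sum_distrib_left)
  also have "(\<Sum>j<q. ?b * ?c * ?t powi (I ! ?r) * ?V *
        (kernel_residue q ?s j * (?t * inverse (?s j)) ^ Suc K / (1 - ?t * inverse (?s j)))) =
     (\<Sum>j<q. ?b * (?c / (1 - ?t * inverse (?s j))) * ?t powi (I ! ?r) * (kernel_residue q ?s j * ?V) *
        ?s j powi (- int (Suc K)) * ?t powi (int (Suc K)))"
    by (intro sum.cong refl)
      (simp add: power_int_minus power_mult_distrib divide_inverse power_inverse mult_ac
        del: of_nat_Suc power_Suc)
  finally show ?thesis unfolding 2 .
qed

text \<open>\<open>Xi_vanish\<close> kills the \<open>q\<close> remainders for large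
  \<open>K\<close>. The equation is stated for every such \<open>K\<close>, so that comparing
  consecutive values shows that single terms vanish from some point on.\<close>

lemma Xi_partial_integrand_step:
  assumes r: "length k < p"
  shows "\<exists>K0::nat. \<forall>K\<ge>K0. Xi N N' (p + q) (partial_integrand p q I J k) =
    (\<Sum>m\<le>K. Xi N N' (p + q) (partial_integrand p q I J (k @ [I ! length k + int m])))"
proof -
  let ?r = "length k"
  let ?t = "\<lambda>zs. 1 - zs ! ?r"
  define Y where "Y = (\<lambda>j zs. partial_base p q I J k {Suc ?r..<p} zs *
        (cross p q zs ?r / (1 - (1 - zs ! ?r) * inverse (tail p zs j))) *
        (1 - zs ! ?r) powi (I ! ?r) * (kernel_residue q (tail p zs) j * tail_kernel p q zs))"
  have Y: "laurent (p + q) {p + j} (Y j)" if "j < q" for j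
    unfolding Y_def using r that
    by (intro laurent_mult laurent_partial_base laurent_cross_divide laurent_residue_tail_kernel
        laurent_one_minus_powi) auto
  define T where "T = (\<lambda>K j zs. Y j zs * (1 - zs ! (p + j)) powi (- int (Suc K)) * (1 - zs ! ?r) powi (int (Suc K)))"
  have T: "laurent (p + q) {} (T K j)" if "j < q" for K j
    unfolding T_def using r that
    by (intro laurent_mult laurent_mono[OF Y] laurent_one_minus_powi) auto
  have "\<exists>K0::nat. \<forall>K\<ge>K0. Xi N N' (p + q) (T K j) = 0" if j: "j < q" for j
  proof -
    obtain K0 where K0: "\<And>K i m. K \<ge> K0 \<Longrightarrow> i < p + q \<Longrightarrow> i \<noteq> p + j \<Longrightarrow>
       Xi N N' (p + q) (\<lambda>zs. Y j zs * (1 - zs ! (p + j)) powi (- int K) * (1 - zs ! i) powi m) = 0"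
      using Xi_vanish[OF Y[OF j], of N N'] j by auto
    then show ?thesis
      unfolding T_def using r by (intro exI[of _ K0] allI impI K0) auto
  qed
  then obtain K0 :: "nat \<Rightarrow> nat" where K0: "\<And>j K. j < q \<Longrightarrow> K \<ge> K0 j \<Longrightarrow> Xi N N' (p + q) (T K j) = 0"
    by metis
  show ?thesis
  proof (intro exI[of _ "Max (insert 0 (K0 ` {..<q}))"] allI impI)
    fix K assume K: "K \<ge> Max (insert 0 (K0 ` {..<q}))"
    let ?P = "\<lambda>m. partial_integrand p q I J (k @ [I ! ?r + int m])"
    have P: "laurent (p + q) {} (?P m)" for m
      using r by (intro laurent_partial_integrand) auto
    have "Xi N N' (p + q) (partial_integrand p q I J k) =
      Xi N N' (p + q) (\<lambda>zs. (\<Sum>m\<le>K. ?P m zs) + (\<Sum>j<q. T K j zs))"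
      using partial_integrand_step[OF _ r]
      by (intro Xi_cong[of _ "{}"] laurent_add laurent_sum P T) (auto simp: T_def Y_def tail_def)
    also have "\<dots> = (\<Sum>m\<le>K. Xi N N' (p + q) (?P m)) + (\<Sum>j<q. Xi N N' (p + q) (T K j))"
      using P T by (subst Xi_add[of _ "{}"]) (auto intro!: laurent_sum arg_cong2[of _ _ _ _ "(+)"] Xi_sum[of _ _ "{}"])
    also have "(\<Sum>j<q. Xi N N' (p + q) (T K j)) = 0"
      using K by (intro sum.neutral ballI K0) auto
    finally show "Xi N N' (p + q) (partial_integrand p q I J k) = (\<Sum>m\<le>K. Xi N N' (p + q) (?P m))"
      by simp
  qed
qed

text \<open>With nothing expanded, all cross factors are cancelled and the two blocks are
  independent, so \<open>Xi_mult\<close> applies.\<close>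

lemma Xi_partial_integrand_Nil:
  assumes "length I = p" "length J = q"
  shows "Xi N N' (p + q) (partial_integrand p q I J []) = grothendieck N N' I * grothendieck N N' J"
proof -
  let ?P = "\<lambda>zs. (\<Prod>j<p. (1 - zs ! j) powi (I ! j)) * groth_kernel p zs"
  let ?Q = "\<lambda>zs. (\<Prod>j<q. (1 - zs ! j) powi (J ! j)) * groth_kernel q zs"
  have P: "laurent p {} ?P" and Q: "laurent q {} ?Q"
    by (intro laurent_mult laurent_prod laurent_one_minus_powi laurent_groth_kernel; simp)+
  have "Xi N N' (p + q) (partial_integrand p q I J []) = Xi N N' (p + q) (\<lambda>zs. ?P (take p zs) * ?Q (drop p zs))"
  proof (rule Xi_cong[symmetric])
    show "laurent (p + q) {} (partial_integrand p q I J [])"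
      by (rule laurent_partial_integrand) simp
    fix zs assume zs: "zs \<in> generic (p + q)"
    have len: "length zs = p + q" using zs by (simp add: generic_def)
    have gp: "groth_kernel p (take p zs) = groth_kernel p zs"
      by (simp add: groth_kernel_def)
    have gq: "groth_kernel q (drop p zs) = (\<Prod>l<q. tail p zs l powi (- (int l + 1))) * tail_kernel p q zs"
    proof -
      have "groth_kernel q (drop p zs) = (\<Prod>l<q. tail p zs l powi (- (int l + 1)) * (1 / zs ! (p + l))) *
          (\<Prod>l<q. \<Prod>m<l. 1 - zs ! (p + l) / zs ! (p + m))"
        using len by (simp add: groth_kernel_def tail_def)
      then show ?thesis unfolding tail_kernel_def prod.distrib by (simp only: mult_ac)
    qed
    \<comment> \<open>Each of the \<open>p\<close> cancellations leaves one factor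
      \<open>s_l\<close>; together they shift the exponents from position \<open>p + l\<close> in
      the concatenation to position \<open>l\<close> in \<open>J\<close>.\<close>
    have "(\<Prod>l<q. tail p zs l) ^ p * (\<Prod>l<q. tail p zs l powi (- (int (p + l) + 1))) =
      (\<Prod>l<q. tail p zs l powi int p * tail p zs l powi (- (int (p + l) + 1)))"
      by (simp add: prod.distrib prod_power_distrib)
    also have "\<dots> = (\<Prod>l<q. tail p zs l powi (- (int l + 1)))"
    proof (intro prod.cong refl)
      fix l assume "l \<in> {..<q}"
      then have "tail p zs l \<noteq> 0" using generic_tail(1)[OF zs] by simp
      then have "tail p zs l powi int p * tail p zs l powi (- (int (p + l) + 1)) =
          tail p zs l powi (int p + - (int (p + l) + 1))"
        by (intro power_int_add[symmetric]) simp
      also have "int p + - (int (p + l) + 1) = - (int l + 1)" by simp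
      finally show "tail p zs l powi int p * tail p zs l powi (- (int (p + l) + 1)) = tail p zs l powi (- (int l + 1))" .
    qed
    finally have "partial_integrand p q I J [] zs =
       (\<Prod>j<p. (1 - zs ! j) powi (I ! j)) * groth_kernel p zs * (\<Prod>l<q. tail p zs l powi (J ! l)) *
         ((\<Prod>l<q. tail p zs l powi (- (int l + 1))) * tail_kernel p q zs)"
      by (simp add: partial_integrand_def partial_base_def prod.distrib atLeast0LessThan[symmetric] mult_ac)
    also have "\<dots> = ?P (take p zs) * ?Q (drop p zs)"
      unfolding gp gq using len by (simp add: tail_def mult_ac)
    finally show "?P (take p zs) * ?Q (drop p zs) = partial_integrand p q I J [] zs" ..
  qed
  also have "\<dots> = Xi N N' p ?P * Xi N N' q ?Q"
    by (rule Xi_mult[OF P Q])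
  finally show ?thesis by (simp add: grothendieck_eq_Xi[OF assms(1)] grothendieck_eq_Xi[OF assms(2)])
qed

section \<open>Laurent coefficients of the kernel\<close>

text \<open>Summable complex families are absolutely summable, which makes the product family
  summable.\<close>

lemma has_sum_times:
  fixes f :: "'a \<Rightarrow> complex" and g :: "'b \<Rightarrow> complex"
  assumes f: "(f has_sum x) A" and g: "(g has_sum y) B"
  shows "((\<lambda>(a, b). f a * g b) has_sum x * y) (A \<times> B)"
proof (rule has_sum_SigmaI)
  show "((\<lambda>b. case (a, b) of (a, b) \<Rightarrow> f a * g b) has_sum f a * y) B" for a
    using has_sum_cmult_right[OF g, of "f a"] by simp
  show "((\<lambda>a. f a * y) has_sum x * y) A"
    by (rule has_sum_cmult_left[OF f])
  have f': "(\<lambda>a. norm (f a)) summable_on A" and g': "(\<lambda>b. norm (g b)) summable_on B"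
    using f g has_sum_imp_summable summable_on_iff_abs_summable_on_complex by blast+
  have "(\<lambda>ab. norm (case ab of (a, b) \<Rightarrow> f a * g b)) summable_on A \<times> B"
    unfolding Infinite_Sum.abs_summable_on_Sigma_iff
  proof (intro conjI ballI)
    show "(\<lambda>b. norm (case (a, b) of (a, b) \<Rightarrow> f a * g b)) summable_on B" for a
      using summable_on_cmult_right[OF g', of "norm (f a)"] by (simp add: norm_mult)
    have "(\<lambda>a. norm (f a) * infsum (\<lambda>b. norm (g b)) B) summable_on A"
      using f' by (rule summable_on_cmult_left)
    moreover have "infsum (\<lambda>b. norm (g b)) B \<ge> 0" by (rule infsum_nonneg) simp
    ultimately show "(\<lambda>a. norm (\<Sum>\<^sub>\<infinity>b\<in>B. norm (case (a, b) of (a, b) \<Rightarrow> f a * g b))) summable_on A"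
      by (simp add: norm_mult infsum_cmult_right')
  qed
  then show "(\<lambda>(a, b). f a * g b) summable_on A \<times> B"
    using summable_on_iff_abs_summable_on_complex by blast
qed

text \<open>A Laurent polynomial together with its integer coefficients: the values are needed
  inside the integrand and the coefficients in the iterated sum.\<close>

definition finite_expansion :: "nat \<Rightarrow> (int list \<Rightarrow> int) \<Rightarrow> (complex list \<Rightarrow> complex) \<Rightarrow> bool" where
  "finite_expansion q \<phi> P \<longleftrightarrow> (\<exists>A. finite A \<and> (\<forall>f\<in>A. length f = q) \<and>
     (\<forall>f. length f = q \<longrightarrow> f \<notin> A \<longrightarrow> \<phi> f = 0) \<and>
     (\<forall>s. length s = q \<longrightarrow> 0 \<notin> set s \<longrightarrow> P s = (\<Sum>f\<in>A. of_int (\<phi> f) * monomial s f)))"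

lemma finite_expansion_cong:
  assumes "finite_expansion q \<phi> P" "\<And>f. length f = q \<Longrightarrow> \<psi> f = \<phi> f"
    "\<And>s. length s = q \<Longrightarrow> 0 \<notin> set s \<Longrightarrow> Q s = P s"
  shows "finite_expansion q \<psi> Q"
proof -
  obtain A where A: "finite A" "\<forall>f\<in>A. length f = q" "\<forall>f. length f = q \<longrightarrow> f \<notin> A \<longrightarrow> \<phi> f = 0"
     "\<forall>s. length s = q \<longrightarrow> 0 \<notin> set s \<longrightarrow> P s = (\<Sum>f\<in>A. of_int (\<phi> f) * monomial s f)"
    using assms(1) by (auto simp: finite_expansion_def)
  show ?thesis
    unfolding finite_expansion_def using A assms(2,3) by (intro exI[of _ A]) auto
qed

lemma finite_expansion_add:
  assumes "finite_expansion q \<phi> P" "finite_expansion q \<psi> Q"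
  shows "finite_expansion q (\<lambda>f. \<phi> f + \<psi> f) (\<lambda>s. P s + Q s)"
proof -
  obtain A where A: "finite A" "\<forall>f\<in>A. length f = q" "\<forall>f. length f = q \<longrightarrow> f \<notin> A \<longrightarrow> \<phi> f = 0"
     "\<forall>s. length s = q \<longrightarrow> 0 \<notin> set s \<longrightarrow> P s = (\<Sum>f\<in>A. of_int (\<phi> f) * monomial s f)"
    using assms(1) by (auto simp: finite_expansion_def)
  obtain B where B: "finite B" "\<forall>f\<in>B. length f = q" "\<forall>f. length f = q \<longrightarrow> f \<notin> B \<longrightarrow> \<psi> f = 0"
     "\<forall>s. length s = q \<longrightarrow> 0 \<notin> set s \<longrightarrow> Q s = (\<Sum>f\<in>B. of_int (\<psi> f) * monomial s f)"
    using assms(2) by (auto simp: finite_expansion_def)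
  have 1: "(\<Sum>f\<in>A. of_int (\<phi> f) * monomial s f) = (\<Sum>f\<in>A \<union> B. of_int (\<phi> f) * monomial s f)" for s
    using A B by (intro sum.mono_neutral_left) auto
  have 2: "(\<Sum>f\<in>B. of_int (\<psi> f) * monomial s f) = (\<Sum>f\<in>A \<union> B. of_int (\<psi> f) * monomial s f)" for s
    using A B by (intro sum.mono_neutral_left) auto
  show ?thesis
    unfolding finite_expansion_def
    using A(1-3) B(1-3) A(4)[unfolded 1] B(4)[unfolded 2]
    by (intro exI[of _ "A \<union> B"]) (auto simp: distrib_right sum.distrib)
qed

lemma finite_expansion_cmult:
  assumes "finite_expansion q \<phi> P"
  shows "finite_expansion q (\<lambda>f. c * \<phi> f) (\<lambda>s. of_int c * P s)"
proof -
  obtain A where A: "finite A" "\<forall>f\<in>A. length f = q" "\<forall>f. length f = q \<longrightarrow> f \<notin> A \<longrightarrow> \<phi> f = 0"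
     "\<forall>s. length s = q \<longrightarrow> 0 \<notin> set s \<longrightarrow> P s = (\<Sum>f\<in>A. of_int (\<phi> f) * monomial s f)"
    using assms(1) by (auto simp: finite_expansion_def)
  show ?thesis
    unfolding finite_expansion_def using A by (intro exI[of _ A]) (auto simp: sum_distrib_left mult.assoc)
qed

lemma finite_expansion_zero: "finite_expansion q (\<lambda>_. 0) (\<lambda>_. 0)"
  unfolding finite_expansion_def by (intro exI[of _ "{}"]) auto

lemma finite_expansion_sum:
  "(\<And>i. i \<in> X \<Longrightarrow> finite_expansion q (\<phi> i) (P i)) \<Longrightarrow>
   finite_expansion q (\<lambda>f. \<Sum>i\<in>X. \<phi> i f) (\<lambda>s. \<Sum>i\<in>X. P i s)"
  by (induction X rule: infinite_finite_induct) (simp_all add: finite_expansion_zero finite_expansion_add)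

lemma monomial_update:
  assumes "length f = n" "length s = n" "0 \<notin> set s" "l < n"
  shows "monomial s (f[l := f ! l + d]) = monomial s f * s ! l powi d"
proof -
  have nz: "s ! l \<noteq> 0" using assms by (metis nth_mem)
  have "monomial s (f[l := f ! l + d]) = s ! l powi (f ! l + d) * (\<Prod>j\<in>{..<n} - {l}. s ! j powi (f[l := f ! l + d] ! j))"
    unfolding monomial_def using assms by (simp add: prod.remove[of _ l])
  also have "(\<Prod>j\<in>{..<n} - {l}. s ! j powi (f[l := f ! l + d] ! j)) = (\<Prod>j\<in>{..<n} - {l}. s ! j powi (f ! j))"
    by (intro prod.cong) auto
  finally show ?thesis
    unfolding monomial_def using assms nz by (simp add: prod.remove[of _ l] power_int_add mult_ac)
qed

lemma finite_expansion_shift: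
  assumes "finite_expansion q \<phi> P" "l < q"
  shows "finite_expansion q (\<lambda>f. \<phi> (f[l := f ! l + d])) (\<lambda>s. P s * s ! l powi (- d))"
proof -
  obtain A where A: "finite A" "\<forall>f\<in>A. length f = q" "\<forall>f. length f = q \<longrightarrow> f \<notin> A \<longrightarrow> \<phi> f = 0"
     "\<forall>s. length s = q \<longrightarrow> 0 \<notin> set s \<longrightarrow> P s = (\<Sum>f\<in>A. of_int (\<phi> f) * monomial s f)"
    using assms(1) by (auto simp: finite_expansion_def)
  \<comment> \<open>The inverse of the shift; it carries the support of \<open>\<phi>\<close> to the
    new support.\<close>
  let ?h = "\<lambda>f::int list. f[l := f ! l + (- d)]"
  have h: "(?h f)[l := ?h f ! l + d] = f" "length (?h f) = q" if "f \<in> A" for f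
    using A(2) that assms(2) by auto
  have inj: "inj_on ?h A" by (rule inj_on_inverseI[of A "\<lambda>f. f[l := f ! l + d]"]) (rule h(1))
  show ?thesis
    unfolding finite_expansion_def
  proof (intro exI[of _ "?h ` A"] conjI allI impI)
    show "finite (?h ` A)" using A(1) by simp
    show "\<forall>f\<in>?h ` A. length f = q" using h(2) by auto
    show "\<phi> (f[l := f ! l + d]) = 0" if "length f = q" "f \<notin> ?h ` A" for f
    proof -
      have "?h (f[l := f ! l + d]) = f" using that assms(2) by simp
      then have "f[l := f ! l + d] \<notin> A" using that(2) imageI[of _ A ?h] by fastforce
      then show ?thesis using A(3) that(1) by simp
    qed
    fix s :: "complex list" assume s: "length s = q" "0 \<notin> set s"
    have "(\<Sum>f\<in>?h ` A. of_int (\<phi> (f[l := f ! l + d])) * monomial s f) =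
       (\<Sum>f\<in>A. of_int (\<phi> f) * monomial s (?h f))"
      using h by (subst sum.reindex[OF inj]) (auto intro!: sum.cong)
    also have "\<dots> = (\<Sum>f\<in>A. of_int (\<phi> f) * (monomial s f * s ! l powi (- d)))"
      using A(2) s assms(2) by (intro sum.cong refl) (subst monomial_update, auto)
    also have "\<dots> = P s * s ! l powi (- d)"
      using A(4) s by (simp add: sum_distrib_right mult.assoc)
    finally show "P s * s ! l powi (- d) = (\<Sum>f\<in>?h ` A. of_int (\<phi> (f[l := f ! l + d])) * monomial s f)" ..
  qed
qed

text \<open>This reads coefficients of \<open>t^b F(t)\<close>, with \<open>b\<close> later equal to
  \<open>I ! i\<close>.\<close>

definition series_coeff :: "int \<Rightarrow> complex fps \<Rightarrow> int \<Rightarrow> complex" where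
  "series_coeff b F m = (if m < b then 0 else fps_nth F (nat (m - b)))"

text \<open>The series \<open>F i s\<close> collects the coefficients of \<open>t\<^sub>i\<close>, with the power \<open>I ! i\<close> split off; they are
  Laurent polynomials in the remaining variables \<open>s\<close>.\<close>

definition expands ::
    "nat \<Rightarrow> nat \<Rightarrow> int list \<Rightarrow> int list \<Rightarrow> (nat \<Rightarrow> complex list \<Rightarrow> complex fps) \<Rightarrow>
     (complex list \<Rightarrow> complex) \<Rightarrow> (int list \<Rightarrow> int) \<Rightarrow> bool" where
  "expands p q I J F R c \<longleftrightarrow> is_laurent_expansion (p + q) R c \<and>
     (\<forall>e i. length e = p + q \<longrightarrow> i < p \<longrightarrow> e ! i < I ! i \<longrightarrow> c e = 0) \<and>
     (\<forall>k. length k = p \<longrightarrow> finite_expansion q (\<lambda>f. c (k @ f))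
        (\<lambda>s. monomial s J * (\<Prod>i<p. series_coeff (I ! i) (F i s) (k ! i))))"

lemma expands_monomial:
  assumes "length I = p" "length J = q"
  shows "expands p q I J (\<lambda>_ _. 1) (\<lambda>t. monomial t (I @ J)) (\<lambda>e. if e = I @ J then 1 else 0)"
  unfolding expands_def
proof (intro conjI allI impI)
  show "is_laurent_expansion (p + q) (\<lambda>t. monomial t (I @ J)) (\<lambda>e. if e = I @ J then 1 else 0)"
    unfolding is_laurent_expansion_def
  proof (intro conjI allI impI)
    fix t
    show "((\<lambda>e. of_int (if e = I @ J then 1 else 0) * monomial t e) has_sum monomial t (I @ J)) {e. length e = p + q}"
      by (rule has_sum_finite_neutralI[of "{I @ J}"]) (use assms in auto)
  qed (use assms in auto)
  show "(if e = I @ J then 1 else 0) = (0::int)" if "length e = p + q" "i < p" "e ! i < I ! i" for e i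
    using that assms by (auto simp: nth_append)
  fix k :: "int list" assume k: "length k = p"
  show "finite_expansion q (\<lambda>f. if k @ f = I @ J then 1 else 0)
        (\<lambda>s. monomial s J * (\<Prod>i<p. series_coeff (I ! i) 1 (k ! i)))"
  proof (cases "k = I")
    case True
    then show ?thesis
      unfolding finite_expansion_def using assms
      by (intro exI[of _ "{J}"]) (auto simp: series_coeff_def)
  next
    case False
    then obtain i where "i < p" "k ! i \<noteq> I ! i" using k assms nth_equalityI by metis
    then have "(\<Prod>i<p. series_coeff (I ! i) 1 (k ! i)) = 0"
      by (intro prod_zero) (auto simp: series_coeff_def intro!: bexI[of _ i])
    moreover have "k @ f \<noteq> I @ J" for f using False k assms(1) by auto
    ultimately show ?thesis by (intro finite_expansion_cong[OF finite_expansion_zero]) simp_all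
  qed
qed

text \<open>Multiplication by a power series in \<open>t_i / s_l^\<delta>\<close>. It covers the
  numerators \<open>1 - t_i\<close> with \<open>\<delta> = 0\<close> and the geometric series with
  \<open>\<delta> = 1\<close>. The convolution of coefficients is finite because \<open>c\<close>
  vanishes when the power of \<open>t_i\<close> lies below \<open>I ! i\<close>.\<close>

lemma expands_mult:
  fixes \<gamma> :: "nat \<Rightarrow> int" and \<delta> :: int
  assumes c: "expands p q I J F R c" and i: "i < p" and l: "l < q"
    and \<rho>: "\<And>t. length t = p + q \<Longrightarrow> 0 \<notin> set t \<Longrightarrow> sorted_wrt (\<lambda>x y. norm x < norm y) t \<Longrightarrow>
      ((\<lambda>a. of_int (\<gamma> a) * (t ! i powi int a * t ! (p + l) powi (- (int a * \<delta>)))) has_sum \<rho> t) UNIV"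
  shows "\<exists>c'. expands p q I J
    (F(i := \<lambda>s. F i s * Abs_fps (\<lambda>a. of_int (\<gamma> a) * s ! l powi (- (int a * \<delta>))))) (\<lambda>t. R t * \<rho> t) c'"
proof -
  \<comment> \<open>\<open>sh a\<close> divides a monomial by the \<open>a\<close>-th power of
    \<open>t_i / s_l^\<delta>\<close>, and \<open>hs a\<close> multiplies by it.\<close>
  define sh :: "nat \<Rightarrow> int list \<Rightarrow> int list" where
    "sh = (\<lambda>a e. e[i := e ! i + (- int a), p + l := e ! (p + l) + int a * \<delta>])"
  define hs :: "nat \<Rightarrow> int list \<Rightarrow> int list" where
    "hs = (\<lambda>a e. e[i := e ! i + int a, p + l := e ! (p + l) + (- (int a * \<delta>))])"
  \<comment> \<open>Beyond this range \<open>sh a e\<close> has its entry at \<open>i\<close> below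
    \<open>I ! i\<close>. If \<open>e ! i < I ! i\<close>, only \<open>a = 0\<close> is left, where
    \<open>c\<close> is 0 as well.\<close>
  define c' where "c' = (\<lambda>e. if length e = p + q then \<Sum>a\<le>nat (e ! i - I ! i). \<gamma> a * c (sh a e) else 0)"
  have il: "i \<noteq> p + l" "i < p + q" "p + l < p + q" using i l by auto
  have len: "length (sh a e) = length e" "length (hs a e) = length e" for a e
    by (simp_all add: sh_def hs_def)
  have sh_hs: "sh a (hs a e) = e" "hs a (sh a e) = e" if "length e = p + q" for a e
    using that il by (auto simp: sh_def hs_def list_eq_iff_nth_eq nth_list_update)
  have c_exp: "is_laurent_expansion (p + q) R c"
    and c0: "\<And>e i. length e = p + q \<Longrightarrow> i < p \<Longrightarrow> e ! i < I ! i \<Longrightarrow> c e = 0"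
    and c_fin: "\<And>k. length k = p \<Longrightarrow> finite_expansion q (\<lambda>f. c (k @ f))
        (\<lambda>s. monomial s J * (\<Prod>i<p. series_coeff (I ! i) (F i s) (k ! i)))"
    using c by (auto simp: expands_def)
  have c_sh0: "c (sh a e) = 0" if "length e = p + q" "a > nat (e ! i - I ! i)" for a e
  proof (rule c0[of _ i])
    show "sh a e ! i < I ! i" using that il by (simp add: sh_def nat_less_iff)
  qed (use that i len in auto)
  have "expands p q I J (F(i := \<lambda>s. F i s * Abs_fps (\<lambda>a. of_int (\<gamma> a) * s ! l powi (- (int a * \<delta>))))) (\<lambda>t. R t * \<rho> t) c'"
    unfolding expands_def
  proof (intro conjI allI impI)
    show "is_laurent_expansion (p + q) (\<lambda>t. R t * \<rho> t) c'"
      unfolding is_laurent_expansion_def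
    proof (intro conjI allI impI)
      show "c' e = 0" if "length e \<noteq> p + q" for e using that by (simp add: c'_def)
      fix t :: "complex list"
      assume "length t = p + q \<and> 0 \<notin> set t \<and> sorted_wrt (\<lambda>x y. norm x < norm y) t"
      then have t: "length t = p + q" "0 \<notin> set t" "sorted_wrt (\<lambda>x y. norm x < norm y) t" by auto
      let ?E = "{e :: int list. length e = p + q}"
      let ?w = "\<lambda>a. t ! i powi int a * t ! (p + l) powi (- (int a * \<delta>))"
      have m: "monomial t (hs a e) = monomial t e * ?w a" if "length e = p + q" for a e
      proof -
        let ?e = "e[i := e ! i + int a]"
        have "hs a e = ?e[p + l := ?e ! (p + l) + (- (int a * \<delta>))]"
          using il by (simp add: hs_def)
        also have "monomial t \<dots> = monomial t ?e * t ! (p + l) powi (- (int a * \<delta>))"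
          by (rule monomial_update) (use that t il in auto)
        also have "monomial t ?e = monomial t e * t ! i powi int a"
          by (rule monomial_update) (use that t il in auto)
        finally show ?thesis by (simp only: mult.assoc)
      qed
      have "((\<lambda>e. of_int (c e) * monomial t e) has_sum R t) ?E"
        using c_exp t by (auto simp: is_laurent_expansion_def)
      from has_sum_times[OF this \<rho>[OF t]]
      have "((\<lambda>(e, a). of_int (c e) * monomial t e * (of_int (\<gamma> a) * ?w a)) has_sum R t * \<rho> t) (?E \<times> UNIV)" .
      \<comment> \<open>Indexing by the exponent of the product instead of that of the first factor
        lets the sum over \<open>a\<close> be taken first.\<close>
      moreover have "((\<lambda>(e, a). of_int (c e) * monomial t e * (of_int (\<gamma> a) * ?w a)) has_sum R t * \<rho> t) (?E \<times> UNIV) \<longleftrightarrow>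
         ((\<lambda>(e, a). of_int (\<gamma> a * c (sh a e)) * monomial t e) has_sum R t * \<rho> t) (?E \<times> UNIV)"
        by (rule has_sum_reindex_bij_witness[of _ "\<lambda>(e, a). (sh a e, a)" "\<lambda>(e, a). (hs a e, a)"])
          (auto simp: sh_hs len m mult_ac)
      ultimately have "((\<lambda>(e, a). of_int (\<gamma> a * c (sh a e)) * monomial t e) has_sum R t * \<rho> t) (?E \<times> UNIV)"
        by simp
      then show "((\<lambda>e. of_int (c' e) * monomial t e) has_sum R t * \<rho> t) ?E"
      proof (rule has_sum_SigmaD)
        fix e assume "e \<in> ?E"
        then have e: "length e = p + q" by simp
        have "((\<lambda>a. of_int (\<gamma> a * c (sh a e)) * monomial t e) has_sum of_int (c' e) * monomial t e) UNIV"
        proof (rule has_sum_finite_neutralI[of "{..nat (e ! i - I ! i)}"])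
          show "of_int (c' e) * monomial t e = (\<Sum>a\<le>nat (e ! i - I ! i). of_int (\<gamma> a * c (sh a e)) * monomial t e)"
            using e by (simp add: c'_def sum_distrib_right)
        qed (use c_sh0[OF e] in auto)
        then show "((\<lambda>a. case (e, a) of (e, a) \<Rightarrow> of_int (\<gamma> a * c (sh a e)) * monomial t e) has_sum of_int (c' e) * monomial t e) UNIV"
          by simp
      qed
    qed
  next
    fix e :: "int list" and j assume e: "length e = p + q" and j: "j < p" "e ! j < I ! j"
    have "c (sh a e) = 0" for a
    proof (rule c0[of _ j])
      have "sh a e ! j \<le> e ! j" using il j e by (auto simp: sh_def nth_list_update)
      then show "sh a e ! j < I ! j" using j(2) by simp
    qed (use e j len in auto)
    then show "c' e = 0" by (simp add: c'_def)
  next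
    fix k :: "int list" assume k: "length k = p"
    let ?d = "nat (k ! i - I ! i)"
    let ?k = "\<lambda>a. k[i := k ! i - int a]"
    have fe: "finite_expansion q (\<lambda>f. \<Sum>a\<le>?d. \<gamma> a * c (?k a @ f[l := f ! l + int a * \<delta>]))
      (\<lambda>s. \<Sum>a\<le>?d. of_int (\<gamma> a) * (monomial s J * (\<Prod>j<p. series_coeff (I ! j) (F j s) (?k a ! j)) * s ! l powi (- (int a * \<delta>))))"
      using k l by (intro finite_expansion_sum finite_expansion_cmult finite_expansion_shift c_fin) auto
    show "finite_expansion q (\<lambda>f. c' (k @ f)) (\<lambda>s. monomial s J * (\<Prod>j<p. series_coeff (I ! j)
        ((F(i := \<lambda>s. F i s * Abs_fps (\<lambda>a. of_int (\<gamma> a) * s ! l powi (- (int a * \<delta>))))) j s) (k ! j)))"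
    proof (rule finite_expansion_cong[OF fe])
      fix f :: "int list" assume f: "length f = q"
      have "sh a (k @ f) = ?k a @ f[l := f ! l + int a * \<delta>]" for a
        using k f i by (simp add: sh_def list_update_append nth_append)
      then show "c' (k @ f) = (\<Sum>a\<le>?d. \<gamma> a * c (?k a @ f[l := f ! l + int a * \<delta>]))"
        using k f i by (simp add: c'_def nth_append)
    next
      fix s :: "complex list"
      let ?x = "\<lambda>a. s ! l powi (- (int a * \<delta>))"
      let ?Q = "\<Prod>j\<in>{..<p} - {i}. series_coeff (I ! j) (F j s) (k ! j)"
      have 1: "(\<Prod>j<p. series_coeff (I ! j) (F j s) (?k a ! j)) = series_coeff (I ! i) (F i s) (k ! i - int a) * ?Q" for a
      proof -
        have "(\<Prod>j\<in>{..<p} - {i}. series_coeff (I ! j) (F j s) (?k a ! j)) = ?Q"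
          by (intro prod.cong) auto
        then show ?thesis using i k by (simp add: prod.remove[of _ i])
      qed
      have 2: "series_coeff (I ! i) (F i s * Abs_fps (\<lambda>a. of_int (\<gamma> a) * ?x a)) (k ! i) =
        (\<Sum>a\<le>?d. of_int (\<gamma> a) * ?x a * series_coeff (I ! i) (F i s) (k ! i - int a))"
      proof (cases "k ! i < I ! i")
        case True
        then show ?thesis by (simp add: series_coeff_def)
      next
        case False
        have "fps_nth (F i s * Abs_fps (\<lambda>a. of_int (\<gamma> a) * ?x a)) ?d =
           (\<Sum>a\<le>?d. of_int (\<gamma> a) * ?x a * fps_nth (F i s) (?d - a))"
          by (subst mult.commute) (simp add: fps_mult_nth atLeast0AtMost)
        also have "\<dots> = (\<Sum>a\<le>?d. of_int (\<gamma> a) * ?x a * series_coeff (I ! i) (F i s) (k ! i - int a))"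
        proof (intro sum.cong refl)
          fix a assume "a \<in> {..?d}"
          then have "\<not> k ! i - int a < I ! i" "nat (k ! i - int a - I ! i) = ?d - a" using False by auto
          then show "of_int (\<gamma> a) * ?x a * fps_nth (F i s) (?d - a) =
             of_int (\<gamma> a) * ?x a * series_coeff (I ! i) (F i s) (k ! i - int a)"
            by (simp add: series_coeff_def)
        qed
        finally show ?thesis using False by (simp add: series_coeff_def)
      qed
      have 3: "(\<Prod>j<p. series_coeff (I ! j) ((F(i := \<lambda>s. F i s * Abs_fps (\<lambda>a. of_int (\<gamma> a) * s ! l powi (- (int a * \<delta>))))) j s) (k ! j))
        = series_coeff (I ! i) (F i s * Abs_fps (\<lambda>a. of_int (\<gamma> a) * ?x a)) (k ! i) * ?Q"
        using i by (subst prod.remove[of _ i]) (auto intro!: prod.cong)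
      show "monomial s J * (\<Prod>j<p. series_coeff (I ! j) ((F(i := \<lambda>s. F i s * Abs_fps (\<lambda>a. of_int (\<gamma> a) * s ! l powi (- (int a * \<delta>))))) j s) (k ! j)) =
        (\<Sum>a\<le>?d. of_int (\<gamma> a) * (monomial s J * (\<Prod>j<p. series_coeff (I ! j) (F j s) (?k a ! j)) * ?x a))"
        unfolding 3 2 1 by (simp add: sum_distrib_left sum_distrib_right mult_ac)
    qed
  qed
  then show ?thesis by blast
qed

section \<open>Iterated summation\<close>

lemma expands_mult_kernel_factor:
  assumes c: "expands p q I J F R c" and i: "i < p" and l: "l < q"
  shows "\<exists>c'. expands p q I J
    (F(i := \<lambda>s. F i s * ((1 - fps_X) * geometric_fps (inverse (s ! l)))))
    (\<lambda>t. R t * ((1 - t ! i) / (1 - t ! i * inverse (t ! (p + l))))) c'"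
proof -
  \<comment> \<open>The coefficients of \<open>1 - t_i\<close>; taking \<open>\<delta> = 0\<close>
    keeps \<open>s_l\<close> out.\<close>
  define \<gamma> :: "nat \<Rightarrow> int" where "\<gamma> = (\<lambda>a. if a = 0 then 1 else if a = 1 then - 1 else 0)"
  have \<gamma>: "Abs_fps (\<lambda>a. of_int (\<gamma> a) * x powi (- (int a * 0))) = 1 - fps_X" for x :: complex
    by (rule fps_ext) (auto simp: \<gamma>_def fps_X_def)
  have geo: "Abs_fps (\<lambda>a. of_int 1 * x powi (- (int a * 1))) = geometric_fps (inverse x)" for x
    by (simp add: geometric_fps_def power_int_minus power_inverse)
  have "((\<lambda>a. of_int (\<gamma> a) * (t ! i powi int a * t ! (p + l) powi (- (int a * 0)))) has_sum 1 - t ! i) UNIV"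
    for t :: "complex list"
    by (rule has_sum_finite_neutralI[of "{0, 1}"]) (auto simp: \<gamma>_def)
  from expands_mult[OF c i l, of \<gamma> 0, OF this]
  obtain c1 where c1: "expands p q I J (F(i := \<lambda>s. F i s * (1 - fps_X))) (\<lambda>t. R t * (1 - t ! i)) c1"
    unfolding \<gamma> by blast
  have "((\<lambda>a. of_int 1 * (t ! i powi int a * t ! (p + l) powi (- (int a * 1)))) has_sum
      1 / (1 - t ! i * inverse (t ! (p + l)))) UNIV"
    if t: "length t = p + q" "0 \<notin> set t" "sorted_wrt (\<lambda>x y. norm x < norm y) t" for t :: "complex list"
  proof -
    let ?x = "t ! i * inverse (t ! (p + l))"
    \<comment> \<open>Position \<open>i\<close> precedes \<open>p + l\<close>, so the domain of
      expansion makes the geometric series converge.\<close>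
    have "norm (t ! i) < norm (t ! (p + l))"
      using sorted_wrt_nth_less[OF t(3), of i "p + l"] i l t(1) by simp
    moreover have "norm (t ! (p + l)) > 0"
      using calculation by (meson le_less_trans norm_ge_zero)
    ultimately have x: "norm ?x < 1" by (simp add: norm_mult norm_inverse norm_divide field_simps)
    then have "summable (\<lambda>a. norm (?x ^ a))"
      by (simp add: norm_power summable_geometric)
    then have "((\<lambda>a. ?x ^ a) has_sum 1 / (1 - ?x)) UNIV"
      using geometric_sums[OF x] by (intro norm_summable_imp_has_sum) auto
    then show ?thesis by (simp add: power_mult_distrib power_int_minus power_inverse)
  qed
  from expands_mult[OF c1 i l, of "\<lambda>_. 1" 1, OF this]
  obtain c2 where "expands p q I J
     ((F(i := \<lambda>s. F i s * (1 - fps_X)))(i := \<lambda>s. (F(i := \<lambda>s. F i s * (1 - fps_X))) i s * geometric_fps (inverse (s ! l))))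
     (\<lambda>t. R t * (1 - t ! i) * (1 / (1 - t ! i * inverse (t ! (p + l))))) c2"
    unfolding geo by blast
  then show ?thesis by (auto simp: mult.assoc)
qed

text \<open>An arbitrary set of pairs allows a single induction over all factors
  \<open>(i, l)\<close> in place of nested ones.\<close>

lemma expands_kernel_product:
  assumes "length I = p" "length J = q" "M \<subseteq> {..<p} \<times> {..<q}"
  shows "\<exists>c. expands p q I J
    (\<lambda>i s. \<Prod>l\<in>M `` {i}. (1 - fps_X) * geometric_fps (inverse (s ! l)))
    (\<lambda>t. monomial t (I @ J) * (\<Prod>(i, l)\<in>M. (1 - t ! i) / (1 - t ! i * inverse (t ! (p + l))))) c"
proof -
  have "finite M" using assms(3) by (rule finite_subset) simp
  then show ?thesis
    using assms(3)
  proof (induction M)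
    case empty
    then show ?case using expands_monomial[OF assms(1,2)] by auto
  next
    case (insert il M)
    obtain i l where il: "il = (i, l)" by (cases il)
    let ?F = "\<lambda>M i s. \<Prod>l\<in>M `` {i}. (1 - fps_X) * geometric_fps (inverse (s ! l))"
    let ?R = "\<lambda>M t. monomial t (I @ J) * (\<Prod>(i, l)\<in>M. (1 - t ! i) / (1 - t ! i * inverse (t ! (p + l))))"
    obtain c where c: "expands p q I J (?F M) (?R M) c" using insert by auto
    have lt: "i < p" "l < q" using insert.prems il by auto
    have "(?F M)(i := \<lambda>s. ?F M i s * ((1 - fps_X) * geometric_fps (inverse (s ! l)))) = ?F (insert il M)"
    proof (intro ext)
      fix j s
      have "insert il M `` {j} = (if j = i then insert l (M `` {i}) else M `` {j})"
        by (auto simp: il)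
      moreover have "l \<notin> M `` {i}" "finite (M `` {i})"
        using insert.hyps by (auto simp: il finite_Image)
      ultimately show "((?F M)(i := \<lambda>s. ?F M i s * ((1 - fps_X) * geometric_fps (inverse (s ! l))))) j s =
          ?F (insert il M) j s"
        by (auto simp: mult.commute)
    qed
    moreover have "(\<lambda>t. ?R M t * ((1 - t ! i) / (1 - t ! i * inverse (t ! (p + l))))) = ?R (insert il M)"
      using insert.hyps by (auto simp: il mult_ac)
    ultimately show ?case
      using expands_mult_kernel_factor[OF c lt] by (simp only:)
  qed
qed

lemma expands_mult_kernel:
  assumes "length I = p" "length J = q"
  obtains c where "expands p q I J (\<lambda>_ s. kernel_fps q ((!) s)) (\<lambda>t. monomial t (I @ J) * mult_kernel p q t) c"
proof -
  have "({..<p} \<times> {..<q}) `` {i} = (if i < p then {..<q} else {})" for i by auto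
  \<comment> \<open>For \<open>i \<ge> p\<close> the image is empty and the two series differ, but
    \<open>expands\<close> evaluates them only under products over \<open>i < p\<close>.\<close>
  then have F: "(\<Prod>l\<in>({..<p} \<times> {..<q}) `` {i}. (1 - fps_X) * geometric_fps (inverse (s ! l))) = kernel_fps q ((!) s)"
    if "i < p" for i and s :: "complex list"
    using that by (simp add: kernel_fps_def prod.distrib)
  then have S: "(\<Prod>i<p. series_coeff (I ! i)
      (\<Prod>l\<in>({..<p} \<times> {..<q}) `` {i}. (1 - fps_X) * geometric_fps (inverse (s ! l))) (k ! i)) =
      (\<Prod>i<p. series_coeff (I ! i) (kernel_fps q ((!) s)) (k ! i))" for s :: "complex list" and k
    by (intro prod.cong refl) (simp only: F lessThan_iff)
  have R: "(\<Prod>(i, l)\<in>{..<p} \<times> {..<q}. (1 - t ! i) / (1 - t ! i * inverse (t ! (p + l)))) = mult_kernel p q t" for t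
    unfolding mult_kernel_def by (simp add: prod_dividef flip: prod.cartesian_product)
  obtain c where "expands p q I J
    (\<lambda>i s. \<Prod>l\<in>({..<p} \<times> {..<q}) `` {i}. (1 - fps_X) * geometric_fps (inverse (s ! l)))
    (\<lambda>t. monomial t (I @ J) * (\<Prod>(i, l)\<in>{..<p} \<times> {..<q}. (1 - t ! i) / (1 - t ! i * inverse (t ! (p + l))))) c"
    using expands_kernel_product[OF assms order_refl] by blast
  then have "expands p q I J (\<lambda>_ s. kernel_fps q ((!) s)) (\<lambda>t. monomial t (I @ J) * mult_kernel p q t) c"
    unfolding expands_def R S .
  then show thesis by (rule that)
qed

section \<open>Iterated sums of Grothendieck polynomials\<close>

lemma has_iterated_sum_finite_support:
  fixes \<phi> :: "int list \<Rightarrow> 'a::comm_monoid_add"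
  assumes "finite A" "\<And>f. f \<in> A \<Longrightarrow> length f = q" "\<And>f. length f = q \<Longrightarrow> f \<notin> A \<Longrightarrow> \<phi> f = 0"
  shows "has_iterated_sum q \<phi> (\<Sum>f\<in>A. \<phi> f)"
  using assms
proof (induction q arbitrary: \<phi> A)
  case 0
  show ?case
  proof (cases "[] \<in> A")
    case True
    then have "A = {[]}" using 0 by auto
    then show ?thesis by simp
  next
    case False
    then have "A = {}" using 0 by auto
    then show ?thesis using 0 by simp
  qed
next
  case (Suc q)
  \<comment> \<open>The support is grouped by first entry, so that \<open>g k\<close> is the partial
    result at the outermost power \<open>k\<close>.\<close>
  define B where "B = (\<lambda>k. {f. k # f \<in> A})"
  define g where "g = (\<lambda>k. \<Sum>f\<in>B k. \<phi> (k # f))"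
  have finB: "finite (B k)" for k
    unfolding B_def using finite_vimageI[OF Suc.prems(1), of "(#) k"] by (simp add: vimage_def)
  have "has_iterated_sum q (\<lambda>e. \<phi> (k # e)) (g k)" for k
    unfolding g_def
    by (rule Suc.IH) (use Suc.prems(3) finB in \<open>auto simp: B_def dest: Suc.prems(2)\<close>)
  moreover have supp: "{k. g k \<noteq> 0} \<subseteq> hd ` A"
  proof
    fix k assume "k \<in> {k. g k \<noteq> 0}"
    then have "B k \<noteq> {}" by (auto simp: g_def)
    then obtain f where "k # f \<in> A" by (auto simp: B_def)
    then show "k \<in> hd ` A" by force
  qed
  moreover have "(\<Sum>f\<in>A. \<phi> f) = (\<Sum>k | g k \<noteq> 0. g k)"
  proof -
    have "g k = (\<Sum>f\<in>{f\<in>A. hd f = k}. \<phi> f)" for k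
    proof -
      have "{f\<in>A. hd f = k} = (#) k ` B k"
      proof (intro equalityI subsetI)
        fix f assume f: "f \<in> {f \<in> A. hd f = k}"
        then have "length f = Suc q" using Suc.prems(2) by auto
        then obtain h f' where "f = h # f'" by (cases f) auto
        then show "f \<in> (#) k ` B k" using f by (auto simp: B_def)
      qed (auto simp: B_def)
      then show ?thesis by (simp add: g_def sum.reindex)
    qed
    then have "(\<Sum>k\<in>hd ` A. g k) = (\<Sum>f\<in>A. \<phi> f)"
      using Suc.prems(1) by (simp add: sum.group)
    moreover have "(\<Sum>k\<in>hd ` A. g k) = (\<Sum>k | g k \<noteq> 0. g k)"
      using supp Suc.prems(1) by (intro sum.mono_neutral_right) auto
    ultimately show ?thesis by simp
  qed
  moreover have "finite {k. g k \<noteq> 0}"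
    using supp Suc.prems(1) by (meson finite_imageI finite_subset)
  ultimately show ?case unfolding has_iterated_sum.simps by blast
qed

text \<open>In \<open>has_groth_value\<close> the integer coefficients act as constant functions in
  a pointwise ring.\<close>

lemma of_int_fun_apply: "(of_int m :: 'a \<Rightarrow> 'b::ring_1) x = of_int m"
  by (cases m) simp_all

text \<open>For fixed powers \<open>k\<close> in the first block the coefficient is a Laurent
  polynomial in \<open>s\<close>. The sum over the second block is therefore finite, and linearity
  of \<open>Xi\<close> moves it inside the integrand.\<close>

lemma has_iterated_sum_tail:
  assumes c: "expands p q I J (\<lambda>_ s. kernel_fps q ((!) s)) R c" and J: "length J = q" and k: "length k = p"
  shows "has_iterated_sum q (\<lambda>f. of_int (c (k @ f)) * grothendieck N N' (k @ f))
    (Xi N N' (p + q) (partial_integrand p q I J k))"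
proof -
  let ?P = "\<lambda>s. monomial s J * (\<Prod>i<p. series_coeff (I ! i) (kernel_fps q ((!) s)) (k ! i))"
  have "finite_expansion q (\<lambda>f. c (k @ f)) ?P"
    using c k by (auto simp: expands_def)
  then obtain A where A: "finite A" "\<forall>f\<in>A. length f = q" "\<forall>f. length f = q \<longrightarrow> f \<notin> A \<longrightarrow> c (k @ f) = 0"
     "\<forall>s. length s = q \<longrightarrow> 0 \<notin> set s \<longrightarrow> ?P s = (\<Sum>f\<in>A. of_int (c (k @ f)) * monomial s f)"
    unfolding finite_expansion_def by blast
  let ?G = "\<lambda>f zs. (\<Prod>j<p + q. (1 - zs ! j) powi ((k @ f) ! j)) * groth_kernel (p + q) zs"
  have G: "laurent (p + q) {} (?G f)" for f
    by (intro laurent_mult laurent_prod laurent_one_minus_powi laurent_groth_kernel) auto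
  have "has_iterated_sum q (\<lambda>f. of_int (c (k @ f)) * grothendieck N N' (k @ f))
    (\<Sum>f\<in>A. of_int (c (k @ f)) * grothendieck N N' (k @ f))"
    using A by (intro has_iterated_sum_finite_support) auto
  also have "(\<Sum>f\<in>A. of_int (c (k @ f)) * grothendieck N N' (k @ f)) =
     (\<Sum>f\<in>A. Xi N N' (p + q) (\<lambda>zs. of_int (c (k @ f)) * ?G f zs))"
  proof (intro sum.cong refl ext)
    fix f \<alpha> \<beta> assume "f \<in> A"
    then have "length (k @ f) = p + q" using A(2) k by simp
    then show "(of_int (c (k @ f)) * grothendieck N N' (k @ f)) \<alpha> \<beta> =
       Xi N N' (p + q) (\<lambda>zs. of_int (c (k @ f)) * ?G f zs) \<alpha> \<beta>"
      by (simp only: grothendieck_eq_Xi Xi_lmult[OF G] times_fun_def of_int_fun_apply)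
  qed
  also have "\<dots> = Xi N N' (p + q) (\<lambda>zs. \<Sum>f\<in>A. of_int (c (k @ f)) * ?G f zs)"
    by (rule Xi_sum[symmetric, of _ _ "{}"]) (intro laurent_mult laurent_const G)
  also have "\<dots> = Xi N N' (p + q) (partial_integrand p q I J k)"
  proof (rule Xi_cong)
    show "laurent (p + q) {} (partial_integrand p q I J k)"
      using k by (intro laurent_partial_integrand) simp
    fix zs assume zs: "zs \<in> generic (p + q)"
    \<comment> \<open>The coefficient identity is evaluated at \<open>s_l = 1 - y_l\<close>, which
      is nonzero on generic lists.\<close>
    let ?s = "map (tail p zs) [0..<q]"
    have s: "length ?s = q" "0 \<notin> set ?s" using generic_tail(1)[OF zs] by auto
    have "kernel_fps q ((!) ?s) = kernel_fps q (tail p zs)"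
      by (auto simp: kernel_fps_def intro!: prod.cong arg_cong2[of _ _ _ _ "(*)"])
    then have sc: "series_coeff (I ! i) (kernel_fps q ((!) ?s)) (k ! i) = kernel_coeff p q zs (k ! i - I ! i)" for i
      by (simp add: series_coeff_def kernel_coeff_def)
    have "?G f zs = (\<Prod>i<p. (1 - zs ! i) powi (k ! i)) * monomial ?s f * groth_kernel (p + q) zs" if "f \<in> A" for f
      using that A(2) k by (simp add: prod_lessThan_add nth_append monomial_def tail_def)
    then have "(\<Sum>f\<in>A. of_int (c (k @ f)) * ?G f zs) =
       (\<Sum>f\<in>A. of_int (c (k @ f)) * ((\<Prod>i<p. (1 - zs ! i) powi (k ! i)) * monomial ?s f * groth_kernel (p + q) zs))"
      by (intro sum.cong) auto
    also have "\<dots> = (\<Prod>i<p. (1 - zs ! i) powi (k ! i)) * ?P ?s * groth_kernel (p + q) zs"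
      using A(4) s by (simp add: sum_distrib_left sum_distrib_right mult_ac)
    also have "monomial ?s J = (\<Prod>l<q. tail p zs l powi (J ! l))"
      using J by (simp add: monomial_def)
    finally show "(\<Sum>f\<in>A. of_int (c (k @ f)) * ?G f zs) = partial_integrand p q I J k zs"
      unfolding partial_integrand_full[OF k] sc by (simp add: mult_ac)
  qed
  finally show ?thesis .
qed

lemma Xi_partial_integrand_eq_0:
  assumes "length k < p" "m < I ! length k"
  shows "Xi N N' (p + q) (partial_integrand p q I J (k @ [m])) = 0"
proof -
  have "partial_integrand p q I J (k @ [m]) = (\<lambda>_. 0)"
    using assms by (intro ext) (simp add: partial_integrand_def partial_base_def kernel_coeff_def nth_append)
  then show ?thesis by (simp add: Xi_0)
qed

text \<open>Induction on the number \<open>d\<close> of first-block variables not yet expanded. The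
  variable at position \<open>length k\<close> is outermost in the remaining sum, and
  \<open>Xi_partial_integrand_step\<close> shows that only finitely many of its powers
  contribute.\<close>

lemma has_iterated_sum_partial:
  assumes c: "expands p q I J (\<lambda>_ s. kernel_fps q ((!) s)) R c" and J: "length J = q" and "length k + d = p"
  shows "has_iterated_sum (d + q) (\<lambda>e. of_int (c (k @ e)) * grothendieck N N' (k @ e))
    (Xi N N' (p + q) (partial_integrand p q I J k))"
  using assms(3)
proof (induction d arbitrary: k)
  case 0
  then have "length k = p" by simp
  then show ?case unfolding add_0 by (rule has_iterated_sum_tail[OF c J])
next
  case (Suc d)
  let ?X = "\<lambda>k. Xi N N' (p + q) (partial_integrand p q I J k)"
  let ?g = "\<lambda>m. ?X (k @ [m])" and ?b = "I ! length k"
  have k: "length k < p" using Suc.prems by simp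
  obtain K0 where K0: "\<And>K. K \<ge> K0 \<Longrightarrow> ?X k = (\<Sum>m\<le>K. ?g (?b + int m))"
    using Xi_partial_integrand_step[OF k, of N N' q I J] by blast
  \<comment> \<open>The partial sums up to \<open>m - 1\<close> and up to \<open>m\<close> are both
    equal to \<open>?X k\<close>, so the term at \<open>m\<close> is 0.\<close>
  have zero: "?g (?b + int m) = 0" if m: "m > K0" for m
  proof -
    obtain m' where m': "m = Suc m'" "m' \<ge> K0" using m by (cases m) auto
    show ?thesis using K0[of m'] K0[of m] m' by simp
  qed
  have supp: "{m. ?g m \<noteq> 0} \<subseteq> (\<lambda>m. ?b + int m) ` {..K0}"
  proof
    fix m assume m: "m \<in> {m. ?g m \<noteq> 0}"
    then have "m \<ge> ?b" using Xi_partial_integrand_eq_0[OF k] by force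
    then obtain m' where m': "m = ?b + int m'" using zle_iff_zadd by blast
    then have "m' \<le> K0" using zero m by force
    then show "m \<in> (\<lambda>m. ?b + int m) ` {..K0}" using m' by blast
  qed
  have "has_iterated_sum (d + q) (\<lambda>e. of_int (c (k @ m # e)) * grothendieck N N' (k @ m # e)) (?g m)" for m
  proof -
    have "length (k @ [m]) + d = p" using Suc.prems by simp
    from Suc.IH[OF this] show ?thesis by (simp only: append_assoc append_Cons append_Nil)
  qed
  moreover have "finite {m. ?g m \<noteq> 0}"
    using supp by (rule finite_subset) simp
  moreover have "?X k = (\<Sum>m | ?g m \<noteq> 0. ?g m)"
  proof -
    have "?X k = (\<Sum>m\<in>(\<lambda>m. ?b + int m) ` {..K0}. ?g m)"
      using K0[of K0] by (subst sum.reindex) (auto simp: inj_on_def)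
    also have "\<dots> = (\<Sum>m | ?g m \<noteq> 0. ?g m)"
      using supp by (intro sum.mono_neutral_right) auto
    finally show ?thesis .
  qed
  ultimately show ?case
    unfolding add_Suc has_iterated_sum.simps by (intro exI[of _ ?g] conjI allI)
qed

theorem theorem2p1:
  fixes I J :: "int list" and N N' p q :: nat
  assumes "length I = p" and "length J = q"
  shows "groth_defined N N' (p + q) (\<lambda>t. monomial t (I @ J) * mult_kernel p q t) \<and>
         grothendieck N N' I * grothendieck N N' J =
           groth_op N N' (p + q) (\<lambda>t. monomial t (I @ J) * mult_kernel p q t)"
proof -
  let ?R = "\<lambda>t. monomial t (I @ J) * mult_kernel p q t"
  obtain c where c: "expands p q I J (\<lambda>_ s. kernel_fps q ((!) s)) ?R c"
    using expands_mult_kernel[OF assms] .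
  \<comment> \<open>The case of no expanded variable: the value is the residue of the closed form,
    which factors into the two Grothendieck polynomials.\<close>
  have "has_iterated_sum (p + q) (\<lambda>e. of_int (c e) * grothendieck N N' e)
      (grothendieck N N' I * grothendieck N N' J)"
    using has_iterated_sum_partial[OF c assms(2), of "[]" p N N'] Xi_partial_integrand_Nil[OF assms] by simp
  moreover have "is_laurent_expansion (p + q) ?R c"
    using c by (simp add: expands_def)
  ultimately have v: "has_groth_value N N' (p + q) ?R (grothendieck N N' I * grothendieck N N' J)"
    by (auto simp: has_groth_value_def)
  then have "groth_op N N' (p + q) ?R = grothendieck N N' I * grothendieck N N' J"
    unfolding groth_op_def using has_groth_value_unique by (intro the_equality) blast+
  then show ?thesis using v by (auto simp: groth_defined_def)
qed

end
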